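(* Consider proper $q$-colorings, i.e. the constraint graph $H=K_q$. The following hold for all $d$. (1) For all $q>d$, $n\ge 1$ and any $G\in\mathcal{G}(n,d)$, there is a structure learning algorithm that, given $L=O(qd^3\log(n^2/\varepsilon))$ independent samples from $\pi_G$, outputs $G$ with probability at least $1-\varepsilon$ and has running time $O(Ln^2)$. (2) For all $q\le d$ and $n\ge q+2$ there exist $q$-colorable graphs $G_1,G_2\in\mathcal{G}(n,d)$ with $G_1\neq G_2$ and $\pi_{G_1}=\pi_{G_2}$. (3) For all $q<d-\sqrt d+\Theta(1)$ there exists a constant $c>0$ such that any equivalent-structure learning algorithm for the family $\mathcal{G}(n,d)$ that succeeds with probability at least $\exp(-cn)$ requires at least $\exp(cn)$ samples, provided $n$ is sufficiently large.
   Context: $K_q$ is the complete graph on $q$ vertices without self-loops, so $K_q$-colorings of a graph $G$ are its proper vertex $q$-colorings; $\Omega_G$ denotes the set of proper $q$-colorings of $G$ and $\pi_G$ the uniform distribution on $\Omega_G$. $\mathcal{G}(n,d)$ is the family of graphs on a fixed set of $n$ vertices with maximum degree at most $d$. A structure learning algorithm for a family $\mathcal{G}$ receives $L$ independent samples from $\pi_G$ for an unknown ($q$-colorable) $G\in\mathcal{G}$ and outputs a graph $\hat G\in\mathcal{G}$; success means $\hat G=G$. An equivalent-structure learning algorithm for $\mathcal{G}$ receives $L$ independent samples from $\pi_G$ for an unknown $G\in\mathcal{G}$ and outputs $G'\in\mathcal{G}$; success means $\Omega_{G'}=\Omega_G$. An algorithm succeeds with probability at least $p$ if for every $G$ in the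 family its success event has probability at least $p$.
   Formalization: Part (2) is proved for q≥2 and part (3) for q≥3, since they fail for smaller q (q=1 allows only the edgeless graph; for q=2, O(log n) samples suffice in (3)); the running time in (1) is O(Ln²+1), as L=0 when d=0; 0<ε<1 is assumed. *)

theory Defs
  imports "HOL-Probability.Probability" "HOL-Library.Ramsey"
begin

section \<open>Graphs and proper colorings\<close>

text \<open>A simple graph on the fixed vertex set \<open>{..<n}\<close> is identified with its edge set, a set of
  two-element subsets of \<open>{..<n}\<close>.\<close>

definition graphs :: "nat \<Rightarrow> nat \<Rightarrow> nat set set set" where
  "graphs n d = {E. E \<subseteq> [{..<n}]\<^bsup>2\<^esup> \<and> (\<forall>v<n. card {e \<in> E. v \<in> e} \<le> d)}"

text \<open>Colorings are extensional functions (\<open>undefined\<close> outside \<open>{..<n}\<close>), so that \<open>colorings n q E\<close>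
  is a finite set with exactly one element per proper coloring.\<close>

definition assignments :: "nat \<Rightarrow> nat \<Rightarrow> (nat \<Rightarrow> nat) set" where
  "assignments n q = ({..<n} \<rightarrow>\<^sub>E {..<q})"

definition colorings :: "nat \<Rightarrow> nat \<Rightarrow> nat set set \<Rightarrow> (nat \<Rightarrow> nat) set" where
  "colorings n q E = {f \<in> assignments n q. \<forall>u v. {u, v} \<in> E \<longrightarrow> f u \<noteq> f v}"

definition colorable :: "nat \<Rightarrow> nat \<Rightarrow> nat set set \<Rightarrow> bool" where
  "colorable n q E \<longleftrightarrow> colorings n q E \<noteq> {}"

text \<open>Meaningful only for colorable graphs, since \<open>pmf_of_set {}\<close> is unspecified.\<close>

definition coloring_pmf :: "nat \<Rightarrow> nat \<Rightarrow> nat set set \<Rightarrow> (nat \<Rightarrow> nat) pmf" where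
  "coloring_pmf n q E = pmf_of_set (colorings n q E)"

section \<open>Learning algorithms\<close>

definition sample_lists :: "nat \<Rightarrow> nat \<Rightarrow> nat \<Rightarrow> (nat \<Rightarrow> nat) list set" where
  "sample_lists n q L = {xs. length xs = L \<and> set xs \<subseteq> assignments n q}"

text \<open>A possibly randomized algorithm maps the list of samples to a distribution of output graphs;
  every possible output has to be a member of the family.\<close>

definition learning_algorithm ::
    "nat \<Rightarrow> nat \<Rightarrow> nat \<Rightarrow> nat \<Rightarrow> ((nat \<Rightarrow> nat) list \<Rightarrow> nat set set pmf) \<Rightarrow> bool" where
  "learning_algorithm n q d L A \<longleftrightarrow> (\<forall>xs \<in> sample_lists n q L. set_pmf (A xs) \<subseteq> graphs n d)"

definition output_pmf ::
    "nat \<Rightarrow> nat \<Rightarrow> nat \<Rightarrow> ((nat \<Rightarrow> nat) list \<Rightarrow> nat set set pmf) \<Rightarrow> nat set set \<Rightarrow> nat set set pmf"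
  where
  "output_pmf n q L A G = bind_pmf (replicate_pmf L (coloring_pmf n q G)) A"

definition structure_learner ::
    "nat \<Rightarrow> nat \<Rightarrow> nat \<Rightarrow> nat \<Rightarrow> real \<Rightarrow> ((nat \<Rightarrow> nat) list \<Rightarrow> nat set set pmf) \<Rightarrow> bool" where
  "structure_learner n q d L p A \<longleftrightarrow> learning_algorithm n q d L A \<and>
     (\<forall>G \<in> graphs n d. colorable n q G \<longrightarrow>
        p \<le> measure_pmf.prob (output_pmf n q L A G) {G})"

definition equivalent_structure_learner ::
    "nat \<Rightarrow> nat \<Rightarrow> nat \<Rightarrow> nat \<Rightarrow> real \<Rightarrow> ((nat \<Rightarrow> nat) list \<Rightarrow> nat set set pmf) \<Rightarrow> bool" where
  "equivalent_structure_learner n q d L p A \<longleftrightarrow> learning_algorithm n q d L A \<and>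
     (\<forall>G \<in> graphs n d. colorable n q G \<longrightarrow>
        p \<le> measure_pmf.prob (output_pmf n q L A G) {G'. colorings n q G' = colorings n q G})"

section \<open>Running time on a unit-cost random access machine\<close>

text \<open>Structured programs for a RAM with addition and truncated subtraction. A state consists of the
  registers and of the memory; \<open>Load\<close> and \<open>Store\<close> address the memory indirectly through a register.\<close>

datatype com =
    Const nat nat          (* register := constant *)
  | Add nat nat nat        (* register := register + register *)
  | Sub nat nat nat        (* register := register - register, truncated at 0 *)
  | Load nat nat           (* register := memory[register] *)
  | Store nat nat          (* memory[register] := register *)
  | Seq com com
  | IfLess nat nat com com
  | WhileLess nat nat com

type_synonym state = "(nat \<Rightarrow> nat) \<times> (nat \<Rightarrow> nat)"

text \<open>\<open>exec c s t s'\<close>: program \<open>c\<close> started in \<open>s\<close> halts in \<open>s'\<close> after exactly \<open>t\<close> steps, where every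
  elementary instruction and every evaluation of a guard is one step.\<close>

inductive exec :: "com \<Rightarrow> state \<Rightarrow> nat \<Rightarrow> state \<Rightarrow> bool" where
  Const: "exec (Const i k) (r, m) 1 (r(i := k), m)"
| Add: "exec (Add i j k) (r, m) 1 (r(i := r j + r k), m)"
| Sub: "exec (Sub i j k) (r, m) 1 (r(i := r j - r k), m)"
| Load: "exec (Load i j) (r, m) 1 (r(i := m (r j)), m)"
| Store: "exec (Store i j) (r, m) 1 (r, m(r i := r j))"
| Seq: "\<lbrakk>exec c1 s t1 s'; exec c2 s' t2 s''\<rbrakk> \<Longrightarrow> exec (Seq c1 c2) s (t1 + t2) s''"
| IfTrue: "\<lbrakk>r i < r j; exec c1 (r, m) t s'\<rbrakk> \<Longrightarrow> exec (IfLess i j c1 c2) (r, m) (1 + t) s'"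
| IfFalse: "\<lbrakk>\<not> r i < r j; exec c2 (r, m) t s'\<rbrakk> \<Longrightarrow> exec (IfLess i j c1 c2) (r, m) (1 + t) s'"
| WhileFalse: "\<not> r i < r j \<Longrightarrow> exec (WhileLess i j c) (r, m) 1 (r, m)"
| WhileTrue: "\<lbrakk>r i < r j; exec c (r, m) t1 s'; exec (WhileLess i j c) s' t2 s''\<rbrakk>
    \<Longrightarrow> exec (WhileLess i j c) (r, m) (1 + t1 + t2) s''"

text \<open>Input convention: registers 0 to 3 contain \<open>n\<close>, \<open>q\<close>, \<open>d\<close> and the number \<open>L\<close> of samples, and
  the memory cell \<open>i * n + v\<close> contains the color of vertex \<open>v\<close> in the \<open>i\<close>-th sample; everything else
  is 0. Output convention: an \<open>n \<times> n\<close> adjacency matrix (of which only the part above the diagonal is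
  read) starting at memory cell \<open>L * n\<close>, directly after the samples.\<close>

definition init_state :: "nat \<Rightarrow> nat \<Rightarrow> nat \<Rightarrow> (nat \<Rightarrow> nat) list \<Rightarrow> state" where
  "init_state n q d xs =
     ((\<lambda>_. 0)(0 := n, 1 := q, 2 := d, 3 := length xs),
      (\<lambda>a. if a < length xs * n then (xs ! (a div n)) (a mod n) else 0))"

definition output_graph :: "nat \<Rightarrow> nat \<Rightarrow> state \<Rightarrow> nat set set" where
  "output_graph n L s = {{u, v} | u v. u < v \<and> v < n \<and> snd s (L * n + u * n + v) \<noteq> 0}"

definition computes ::
    "com \<Rightarrow> nat \<Rightarrow> nat \<Rightarrow> nat \<Rightarrow> nat \<Rightarrow> real \<Rightarrow> ((nat \<Rightarrow> nat) list \<Rightarrow> nat set set) \<Rightarrow> bool" where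
  "computes P n q d L T F \<longleftrightarrow>
     (\<forall>xs \<in> sample_lists n q L. \<exists>t s. exec P (init_state n q d xs) t s \<and> real t \<le> T \<and>
        output_graph n L s = F xs)"

end

theory Submission
  imports Defs
begin

text \<open>(1) For \<open>q > d\<close>, two non-adjacent vertices get equal colors with probability at least
  \<open>1 / (6 q d\<^sup>3)\<close>, so after \<open>O(q d\<^sup>3 ln (n\<^sup>2 / \<epsilon>))\<close> samples the pairs that were never
  seen with equal colors are exactly the edges. The program inserts such pairs greedily as long as
  the degree bound permits, so that its output lies in the family for every input.

  (2) In \<open>K\<^sub>q\<^sub>+\<^sub>1\<close> minus an edge the two non-adjacent vertices are forced to agree; a pendant vertex can
  be attached to either of them.

  (3) The same forcing, iterated, makes long chains that act as single vertices \<open>x\<close> and \<open>y\<close> of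
  unbounded degree. Linearly many common neighbors make the event that \<open>x\<close> and \<open>y\<close> get different
  colors exponentially unlikely, and given that they agree, it does not matter which of the two a
  pendant vertex is attached to. The exponentially many ways to attach linearly many pendant vertices
  give pairwise different sets of colorings whose uniform distributions are exponentially close.\<close>

section \<open>Uniform samples and indistinguishable distributions\<close>

text \<open>In (3) the success probability to be ruled out is itself exponentially small. Two
  indistinguishable graphs would only rule out values above about 1/2, hence the exponentially many
  graphs; and their distributions are compared not pairwise but through one set
  \<open>common\<close> of colorings shared by all of them, on which a learner can do no better than
  guess. The threshold for q is the price of the chains. A clique vertex sees q - 2 clique vertices,
  the independent set of its level and one vertex of the previous level; an independent vertex sees
  q - 1 clique vertices, the block of the next clique that it supports, and one hanging vertex. With
  t + 1 independent vertices and blocks of size t both degrees are at most q + t, and the blocks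
  cover the next clique iff q - 1 \<le> t * (t + 1). For t = d - q this puts q below d - sqrt d up
  to a constant. In (1) the assumption d < q enters twice: it leaves colors that occur at most once
  around \<open>u\<close> and \<open>v\<close>, and it leaves a free color for the one vertex that
  has to give way.\<close>

definition lists_of :: "'a set \<Rightarrow> nat \<Rightarrow> 'a list set" where
  "lists_of A L = {xs. set xs \<subseteq> A \<and> length xs = L}"

lemma finite_lists_of: "finite A \<Longrightarrow> finite (lists_of A L)"
  by (simp add: lists_of_def finite_lists_length_eq)

lemma card_lists_of: "finite A \<Longrightarrow> card (lists_of A L) = card A ^ L"
  by (simp add: lists_of_def card_lists_length_eq)

lemma lists_of_nonempty: "A \<noteq> {} \<Longrightarrow> lists_of A L \<noteq> {}"
proof -
  assume "A \<noteq> {}"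
  then obtain a where "a \<in> A" by blast
  hence "replicate L a \<in> lists_of A L" by (auto simp: lists_of_def)
  thus ?thesis by blast
qed

lemma lists_of_mono: "A \<subseteq> B \<Longrightarrow> lists_of A L \<subseteq> lists_of B L"
  by (auto simp: lists_of_def)

lemma lists_of_Suc: "lists_of A (Suc L) = (\<lambda>(x, xs). x # xs) ` (A \<times> lists_of A L)"
  by (auto simp: lists_of_def length_Suc_conv image_iff)

text \<open>Independent uniform samples amount to one uniform choice from a finite set of lists, so
  every probability below becomes a ratio of cardinalities.\<close>

lemma replicate_pmf_of_set:
  assumes "finite A" "A \<noteq> {}"
  shows "replicate_pmf L (pmf_of_set A) = pmf_of_set (lists_of A L)"
proof (induction L)
  case 0
  have "lists_of A 0 = {[]}" by (auto simp: lists_of_def)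
  then show ?case by (simp add: pmf_of_set_singleton)
next
  case (Suc L)
  have "replicate_pmf (Suc L) (pmf_of_set A) =
      map_pmf (\<lambda>(x, xs). x # xs) (pair_pmf (pmf_of_set A) (pmf_of_set (lists_of A L)))"
    by (simp add: Suc pair_pmf_def map_bind_pmf map_pmf_def bind_assoc_pmf bind_return_pmf)
  also have "pair_pmf (pmf_of_set A) (pmf_of_set (lists_of A L)) = pmf_of_set (A \<times> lists_of A L)"
  proof (rule pmf_eqI)
    fix z :: "'a \<times> 'a list"
    have "A \<times> lists_of A L \<noteq> {}" "finite (A \<times> lists_of A L)"
      using assms finite_lists_of[of A L] lists_of_nonempty[of A L] by auto
    thus "pmf (pair_pmf (pmf_of_set A) (pmf_of_set (lists_of A L))) z = pmf (pmf_of_set (A \<times> lists_of A L)) z"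
      using assms finite_lists_of[of A L] lists_of_nonempty[of A L]
      by (cases z) (simp add: pmf_pair indicator_def)
  qed
  also have "map_pmf (\<lambda>(x, xs). x # xs) \<dots> = pmf_of_set (lists_of A (Suc L))"
    unfolding lists_of_Suc using assms finite_lists_of[of A L] lists_of_nonempty[of A L]
    by (intro map_pmf_of_set_inj) (auto simp: inj_on_def)
  finally show ?case .
qed

section \<open>Success probabilities as averages over sample lists\<close>

lemma finite_assignments: "finite (assignments n q)"
  by (simp add: assignments_def finite_PiE)

lemma finite_colorings: "finite (colorings n q E)"
  using finite_assignments by (simp add: colorings_def)

lemma output_pmf_eq:
  assumes "colorable n q G"
  shows "output_pmf n q L A G = bind_pmf (pmf_of_set (lists_of (colorings n q G) L)) A"
  using assms replicate_pmf_of_set[OF finite_colorings[of n q G]]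
  by (simp add: output_pmf_def coloring_pmf_def colorable_def)

lemma prob_bind_pmf_of_set:
  assumes "finite S" "S \<noteq> {}"
  shows "measure_pmf.prob (bind_pmf (pmf_of_set S) A) T =
    (\<Sum>x\<in>S. measure_pmf.prob (A x) T) / card S"
proof -
  have "measure_pmf.prob (bind_pmf (pmf_of_set S) A) T =
      (\<integral>x. measure_pmf.prob (A x) T \<partial>measure_pmf (pmf_of_set S))"
    unfolding measure_pmf_bind
    by (subst measure_pmf.measure_bind[where N="count_space UNIV"])
      (auto simp: space_subprob_algebra intro: prob_space_imp_subprob_space measure_pmf.prob_space_axioms)
  thus ?thesis using assms by (simp add: integral_pmf_of_set)
qed

text \<open>All samples lie in the common core \<open>D\<close> with probability at least 1 - L *
  \<delta>, and on lists over \<open>D\<close> the input no longer depends on \<open>i\<close>.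
  There the output is a guess: the targets \<open>T i\<close> are disjoint, so its success
  probabilities over all \<open>i\<close> add up to at most 1.\<close>

lemma sum_success_le:
  fixes \<Omega> :: "'i \<Rightarrow> 'a set" and A :: "'a list \<Rightarrow> 'b pmf" and \<delta> p :: real
  assumes "finite I" and fin: "\<And>i. i \<in> I \<Longrightarrow> finite (\<Omega> i)" and ne: "\<And>i. i \<in> I \<Longrightarrow> \<Omega> i \<noteq> {}"
    and sub: "\<And>i. i \<in> I \<Longrightarrow> D \<subseteq> \<Omega> i"
    and rare: "\<And>i. i \<in> I \<Longrightarrow> real (card (\<Omega> i - D)) \<le> \<delta> * card (\<Omega> i)"
    and \<delta>: "\<delta> \<le> 1"
    and disj: "disjoint_family_on T I"
    and succ: "\<And>i. i \<in> I \<Longrightarrow>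
      p \<le> measure_pmf.prob (bind_pmf (pmf_of_set (lists_of (\<Omega> i) L)) A) (T i)"
  shows "card I * p \<le> card I * (L * \<delta>) + 1"
proof (cases "I = {}")
  case True
  then show ?thesis by simp
next
  case False
  define S0 where "S0 = lists_of D L"
  have finD: "finite D" using False fin sub by (meson all_not_in_conv finite_subset)
  have fS0: "finite S0" by (simp add: S0_def finite_lists_of finD)
  define g where "g i = (\<Sum>x\<in>S0. measure_pmf.prob (A x) (T i)) / card S0" for i
  have step: "p \<le> g i + L * \<delta>" if i: "i \<in> I" for i
  proof -
    define S where "S = lists_of (\<Omega> i) L"
    have fS: "finite S" by (simp add: S_def finite_lists_of fin i)
    have S: "S \<noteq> {}" by (simp add: S_def lists_of_nonempty ne i)
    have cS: "card S > 0" using fS S by (simp add: card_gt_0_iff)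
    have SS: "S0 \<subseteq> S" unfolding S0_def S_def by (rule lists_of_mono) (rule sub[OF i])
    have c0: "card (\<Omega> i) > 0" using fin ne i by (simp add: card_gt_0_iff)
    have rat: "(1 - \<delta>) \<le> card D / card (\<Omega> i)"
    proof -
      have "card (\<Omega> i - D) = card (\<Omega> i) - card D"
        by (rule card_Diff_subset[OF finD sub[OF i]])
      moreover have "card D \<le> card (\<Omega> i)" by (rule card_mono[OF fin[OF i] sub[OF i]])
      ultimately have "real (card (\<Omega> i)) - card D \<le> \<delta> * card (\<Omega> i)"
        using rare[OF i] by (simp add: of_nat_diff)
      thus ?thesis using c0 by (simp add: field_simps)
    qed
    \<comment> \<open>Bernoulli's inequality plays the role of a union bound over the samples; it is
      applicable because \<delta> \<le> 1.\<close>
    have "1 + real L * (- \<delta>) \<le> (1 + (- \<delta>)) ^ L"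
      using \<delta> by (intro Bernoulli_inequality) auto
    also have "\<dots> \<le> (card D / card (\<Omega> i)) ^ L" using rat \<delta> by (intro power_mono) auto
    also have "\<dots> = card S0 / card S"
      unfolding S0_def S_def using finD fin i by (simp add: card_lists_of power_divide)
    finally have bern: "1 - L * \<delta> \<le> card S0 / card S" by simp
    have "p \<le> (\<Sum>x\<in>S. measure_pmf.prob (A x) (T i)) / card S"
      using succ[OF i] unfolding S_def[symmetric] prob_bind_pmf_of_set[OF fS S] .
    also have "(\<Sum>x\<in>S. measure_pmf.prob (A x) (T i)) =
       (\<Sum>x\<in>S0. measure_pmf.prob (A x) (T i)) + (\<Sum>x\<in>S-S0. measure_pmf.prob (A x) (T i))"
      by (metis SS add.commute fS sum.subset_diff)
    also have "(\<Sum>x\<in>S-S0. measure_pmf.prob (A x) (T i)) \<le> (\<Sum>x\<in>S-S0. 1)"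
      by (intro sum_mono) simp
    also have "\<dots> = card S - card S0"
      using card_Diff_subset[OF fS0 SS] card_mono[OF fS SS] by (simp add: of_nat_diff)
    finally have "p \<le> ((\<Sum>x\<in>S0. measure_pmf.prob (A x) (T i)) + (real (card S) - card S0)) / card S"
      using cS card_mono[OF fS SS] by (simp add: divide_right_mono of_nat_diff)
    also have "\<dots> = (\<Sum>x\<in>S0. measure_pmf.prob (A x) (T i)) / card S + (1 - card S0 / card S)"
      using cS by (simp add: add_divide_distrib diff_divide_distrib)
    \<comment> \<open>Replacing \<open>card S\<close> by \<open>card S0\<close> makes the
      normalization independent of \<open>i\<close>, so that the two sums can be exchanged below.
      For empty \<open>S0\<close> both sides are 0.\<close>
    also have "(\<Sum>x\<in>S0. measure_pmf.prob (A x) (T i)) / card S \<le> g i"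
    proof (cases "S0 = {}")
      case True
      then show ?thesis by (simp add: g_def)
    next
      case False
      hence "card S0 > 0" using fS0 by (simp add: card_gt_0_iff)
      thus ?thesis unfolding g_def using card_mono[OF fS SS] 
        by (intro divide_left_mono) (auto intro!: sum_nonneg)
    qed
    finally show ?thesis using bern by linarith
  qed
  have "(\<Sum>i\<in>I. g i) = (\<Sum>x\<in>S0. \<Sum>i\<in>I. measure_pmf.prob (A x) (T i)) / card S0"
    unfolding g_def by (subst sum.swap) (simp add: sum_divide_distrib)
  also have "\<dots> \<le> (\<Sum>x\<in>S0. 1) / card S0"
  proof (intro divide_right_mono sum_mono)
    fix x assume "x \<in> S0"
    have "(\<Sum>i\<in>I. measure_pmf.prob (A x) (T i)) = measure_pmf.prob (A x) (\<Union>i\<in>I. T i)"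
      using \<open>finite I\<close> disj
      by (intro measure_pmf.finite_measure_finite_Union[symmetric]) auto
    thus "(\<Sum>i\<in>I. measure_pmf.prob (A x) (T i)) \<le> 1" by simp
  qed simp
  also have "\<dots> \<le> 1" by simp
  finally have g: "(\<Sum>i\<in>I. g i) \<le> 1" .
  have "card I * p = (\<Sum>i\<in>I. p)" by simp
  also have "\<dots> \<le> (\<Sum>i\<in>I. g i + L * \<delta>)" by (intro sum_mono step)
  also have "\<dots> \<le> card I * (L * \<delta>) + 1" using g by (simp add: sum.distrib)
  finally show ?thesis .
qed

section \<open>Different graphs with the same colorings\<close>

lemma colorings_insert:
  "f \<in> colorings n q (insert {a, b} E) \<longleftrightarrow> f \<in> colorings n q E \<and> f a \<noteq> f b"
proof -
  have "(\<forall>u v. {u, v} \<in> insert {a, b} E \<longrightarrow> f u \<noteq> f v) \<longleftrightarrow>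
      f a \<noteq> f b \<and> (\<forall>u v. {u, v} \<in> E \<longrightarrow> f u \<noteq> f v)"
    by (metis doubleton_eq_iff insert_iff)
  thus ?thesis by (auto simp: colorings_def)
qed

text \<open>The missing edge joins q - 1 and q. It leaves these two vertices with degree q - 1, and
  the pendant vertex q + 1 fills the last slot of one of them, so maximum degree q is enough. All
  vertices above q + 1 are isolated.\<close>

lemma two_graphs_same_colorings:
  fixes d q n :: nat
  assumes "2 \<le> q" "q \<le> d" "q + 2 \<le> n"
  shows "\<exists>G1 \<in> graphs n d. \<exists>G2 \<in> graphs n d.
           colorable n q G1 \<and> colorable n q G2 \<and> G1 \<noteq> G2 \<and>
           coloring_pmf n q G1 = coloring_pmf n q G2"
proof -
  define K where "K = {..<q - 1}"
  define B where "B = {{a, b} | a b. a \<in> K \<and> b \<le> q \<and> a \<noteq> b}"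
  have graph: "insert {x, q + 1} B \<in> graphs n d" if x: "x = q - 1 \<or> x = q" for x
  proof -
    let ?G = "insert {x, q + 1} B"
    have "?G \<subseteq> [{..<n}]\<^bsup>2\<^esup>" using assms x by (auto simp: B_def K_def)
    moreover have "card {e \<in> ?G. v \<in> e} \<le> d" if "v < n" for v
    proof -
      consider "v < q - 1" | "v = q - 1 \<or> v = q" | "v = q + 1" | "v > q + 1" by linarith
      then show ?thesis
      proof cases
        case 1
        have "{e \<in> ?G. v \<in> e} \<subseteq> (\<lambda>b. {v, b}) ` ({..q} - {v})"
        proof (rule subsetI)
          fix e assume "e \<in> {e \<in> ?G. v \<in> e}"
          hence e: "e \<in> ?G" "v \<in> e" by simp_all
          have "v \<notin> {x, q + 1}" using 1 x by auto
          hence "e \<in> B" using e by blast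
          then obtain a b where "e = {a, b}" "a \<in> K" "b \<le> q" "a \<noteq> b"
            unfolding B_def by blast
          moreover from this have "a \<le> q" by (simp add: K_def)
          ultimately have "e = {v, if v = a then b else a}" "(if v = a then b else a) \<in> {..q} - {v}"
            using e(2) by auto
          thus "e \<in> (\<lambda>b. {v, b}) ` ({..q} - {v})" by blast
        qed
        hence "card {e \<in> ?G. v \<in> e} \<le> card ({..q} - {v})"
          by (rule surj_card_le[rotated]) simp
        also have "\<dots> = q" using 1 by simp
        finally show ?thesis using assms by simp
      next
        case 2
        have "{e \<in> ?G. v \<in> e} \<subseteq> (\<lambda>b. {v, b}) ` (insert (q + 1) K)"
        proof (rule subsetI)
          fix e assume "e \<in> {e \<in> ?G. v \<in> e}"
          hence e: "e \<in> ?G" "v \<in> e" by simp_all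
          show "e \<in> (\<lambda>b. {v, b}) ` (insert (q + 1) K)"
          proof (cases "e \<in> B")
            case True
            then obtain a b where "e = {a, b}" "a \<in> K" "b \<le> q" "a \<noteq> b"
              unfolding B_def by blast
            moreover have "v \<noteq> a" using 2 \<open>a \<in> K\<close> by (auto simp: K_def)
            ultimately have "e = {v, a}" using e(2) by auto
            then show ?thesis using \<open>a \<in> K\<close> by blast
          next
            case False
            hence "e = {x, q + 1}" using e(1) by simp
            moreover have "v \<noteq> q + 1" using 2 by auto
            ultimately have "e = {v, q + 1}" using e(2) by auto
            then show ?thesis by blast
          qed
        qed
        hence "card {e \<in> ?G. v \<in> e} \<le> card (insert (q + 1) K)"
          by (rule surj_card_le[rotated]) (simp add: K_def)
        also have "\<dots> \<le> q" using assms by (simp add: K_def card_insert_if)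
        finally show ?thesis using assms by simp
      next
        case 3
        have "v \<notin> e" if "e \<in> B" for e using that 3 by (auto simp: B_def K_def)
        hence "{e \<in> ?G. v \<in> e} \<subseteq> {{x, q + 1}}" by blast
        hence "card {e \<in> ?G. v \<in> e} \<le> card {{x, q + 1}}"
          by (rule card_mono[rotated]) simp
        then show ?thesis using assms by simp
      next
        case 4
        have "v \<notin> e" if "e \<in> B" for e using that 4 by (auto simp: B_def K_def)
        moreover have "v \<notin> {x, q + 1}" using 4 x by auto
        ultimately have "{e \<in> ?G. v \<in> e} = {}" by blast
        then show ?thesis by (metis card.empty zero_le)
      qed
    qed
    ultimately show ?thesis by (simp add: graphs_def)
  qed
  have forced: "f (q - 1) = f q" if f: "f \<in> assignments n q" and B: "\<forall>u v. {u, v} \<in> B \<longrightarrow> f u \<noteq> f v" for f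
  proof -
    have adj: "f a \<noteq> f b" if "a \<in> K" "b \<le> q" "a \<noteq> b" for a b
      using B that unfolding B_def by blast
    have lt: "f v < q" if "v \<le> q" for v
    proof -
      have "v < n" using that assms by linarith
      thus ?thesis using f by (auto simp: assignments_def PiE_iff)
    qed
    have "inj_on f K" using adj by (intro inj_onI) (metis K_def diff_le_self lessThan_iff less_imp_le order_trans)
    hence "card (f ` K) = q - 1" by (simp add: card_image K_def)
    moreover have "f ` K \<subseteq> {..<q}" using lt by (auto simp: K_def)
    ultimately have "card ({..<q} - f ` K) = 1"
      using assms by (subst card_Diff_subset) (auto simp: K_def)
    then obtain c where c: "{..<q} - f ` K = {c}" by (rule card_1_singletonE)
    have "f b \<in> {..<q} - f ` K" if "b = q - 1 \<or> b = q" for b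
      using that adj[of _ b] lt[of b] assms by (fastforce simp: K_def)
    thus ?thesis using c by (metis singletonD)
  qed
  have eq: "colorings n q (insert {q - 1, q + 1} B) = colorings n q (insert {q, q + 1} B)"
  proof -
    have "(f \<in> colorings n q (insert {q - 1, q + 1} B)) = (f \<in> colorings n q (insert {q, q + 1} B))" for f
      using forced[of f] unfolding colorings_insert by (auto simp: colorings_def)
    thus ?thesis by blast
  qed
  \<comment> \<open>The pendant vertex must avoid q - 1, the color of both its possible neighbors;
    color 0 does, since 2 \<le> q.\<close>
  have "restrict (\<lambda>v. if v < q - 1 then v else if v \<le> q then q - 1 else 0) {..<n}
      \<in> colorings n q (insert {q, q + 1} B)"
    using assms by (auto simp: colorings_def assignments_def B_def K_def doubleton_eq_iff split: if_splits)
  hence col: "colorable n q (insert {q, q + 1} B)" by (auto simp: colorable_def)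
  have "{q, q + 1} \<notin> insert {q - 1, q + 1} B"
    using assms by (auto simp: B_def K_def doubleton_eq_iff)
  hence "insert {q - 1, q + 1} B \<noteq> insert {q, q + 1} B" by blast
  with graph[of q] graph[of "q - 1"] col eq show ?thesis
    by (intro bexI[of _ "insert {q - 1, q + 1} B"] bexI[of _ "insert {q, q + 1} B"])
      (auto simp: colorable_def coloring_pmf_def)
qed

section \<open>Non-adjacent vertices often agree\<close>

definition nbhd :: "nat set set \<Rightarrow> nat \<Rightarrow> nat set" where
  "nbhd G x = {w. {x, w} \<in> G}"

lemma graphs_edge:
  assumes "G \<in> graphs n d" "{x, w} \<in> G"
  shows "x < n" "w < n" "x \<noteq> w"
proof -
  have "{x, w} \<in> [{..<n}]\<^bsup>2\<^esup>" using assms unfolding graphs_def by blast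
  thus "x < n" "w < n" "x \<noteq> w" by simp_all
qed

lemma graph_edge_cases:
  assumes "G \<in> graphs n d" "e \<in> G"
  obtains u v where "e = {u, v}" "u < v" "v < n"
proof -
  have "e \<in> [{..<n}]\<^bsup>2\<^esup>" using assms unfolding graphs_def by blast
  then obtain a b where ab: "e = {a, b}" "a < n" "b < n" "a \<noteq> b" by (auto elim: nsets2_E)
  show ?thesis
  proof (cases "a < b")
    case True then show ?thesis using ab that by blast
  next
    case False then show ?thesis using ab that[of b a] by (simp add: insert_commute)
  qed
qed

lemma nbhd_subset: "G \<in> graphs n d \<Longrightarrow> nbhd G x \<subseteq> {..<n}"
  using graphs_edge by (auto simp: nbhd_def)

lemma finite_nbhd: "G \<in> graphs n d \<Longrightarrow> finite (nbhd G x)"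
  by (rule finite_subset[OF nbhd_subset]) auto

lemma finite_graph: "G \<in> graphs n d \<Longrightarrow> finite G"
  unfolding graphs_def by (auto intro: finite_subset[OF _ finite_imp_finite_nsets])

lemma card_nbhd:
  assumes "G \<in> graphs n d" "x < n"
  shows "card (nbhd G x) \<le> d"
proof -
  have "card (nbhd G x) \<le> card {e \<in> G. x \<in> e}"
    using finite_graph[OF assms(1)]
    by (intro card_inj_on_le[where f="\<lambda>w. {x, w}"])
      (auto simp: inj_on_def nbhd_def doubleton_eq_iff)
  thus ?thesis using assms unfolding graphs_def by fastforce
qed

text \<open>The double count relates a coloring to those obtained by picking a color \<open>c\<close> that occurs at most
  once on the neighborhood of \<open>{u, v}\<close>, freeing the single occurrence and giving \<open>c\<close> to both \<open>u\<close>
  and \<open>v\<close>.\<close>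

lemma recoloring_exists:
  assumes G: "G \<in> graphs n d" and "d < q" and uv: "u < n" "v < n" "u \<noteq> v" "{u, v} \<notin> G"
    and f: "f \<in> colorings n q G" and "c < q"
    and once: "card {w \<in> nbhd G u \<union> nbhd G v. f w = c} \<le> 1"
  obtains g w where "g \<in> colorings n q G" "g u = c" "g v = c" "w \<in> insert u (nbhd G u \<union> nbhd G v)"
    "f = (g(w := c))(u := f u, v := f v)"
proof -
  let ?M = "nbhd G u \<union> nbhd G v"
  have fin: "finite {w \<in> ?M. f w = c}" using finite_nbhd[OF G] by simp
  have uvM: "u \<notin> ?M" "v \<notin> ?M" 
    using uv graphs_edge(3)[OF G, of u u] graphs_edge(3)[OF G, of v v]
    by (auto simp: nbhd_def insert_commute)
  have fa: "f \<in> assignments n q" and fp: "\<And>x y. {x, y} \<in> G \<Longrightarrow> f x \<noteq> f y"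
    using f by (auto simp: colorings_def)
  consider "{w \<in> ?M. f w = c} = {}" | w where "{w \<in> ?M. f w = c} = {w}"
  proof -
    have "card {w \<in> ?M. f w = c} = 0 \<or> card {w \<in> ?M. f w = c} = 1" using once by linarith
    thus ?thesis
    proof
      assume "card {w \<in> ?M. f w = c} = 0"
      thus ?thesis using that(1) fin by simp
    next
      assume "card {w \<in> ?M. f w = c} = 1"
      thus ?thesis using that(2) by (rule card_1_singletonE)
    qed
  qed
  then show ?thesis
  proof cases
    case 1
    let ?g = "f(u := c, v := c)"
    have "?g \<in> assignments n q"
      using fa uv \<open>c < q\<close> by (auto simp: assignments_def PiE_iff extensional_def)
    moreover have "?g x \<noteq> ?g y" if "{x, y} \<in> G" for x y
      using that fp[OF that] 1 uvM graphs_edge(3)[OF G that] uv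
      by (auto simp: nbhd_def insert_commute)
    ultimately have "?g \<in> colorings n q G" by (simp add: colorings_def)
    \<comment> \<open>No vertex has to be freed. \<open>u\<close> serves as a dummy for
      \<open>w\<close>, because its color is overwritten when \<open>f\<close> is recovered.\<close>
    then show ?thesis using uv by (intro that[of ?g u]) auto
  next
    case (2 w)
    hence w: "w \<in> ?M" "f w = c" by auto
    have only: "y = w" if "y \<in> ?M" "f y = c" for y using 2 that by blast
    have wn: "w < n" using w nbhd_subset[OF G] by blast
    have wne: "w \<noteq> u" "w \<noteq> v" using w uvM by auto
    \<comment> \<open>\<open>w\<close> is adjacent to \<open>u\<close> or \<open>v\<close>, both of
      which end up with color \<open>c\<close>. So only \<open>c\<close> and the colors of at most d
      - 1 other neighbors are forbidden for \<open>w\<close>, fewer than q colors in all.\<close>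
    have "card (nbhd G w - {u, v}) < card (nbhd G w)"
      using w by (intro psubset_card_mono finite_nbhd[OF G]) (auto simp: nbhd_def insert_commute)
    hence "card (nbhd G w - {u, v}) < d" using card_nbhd[OF G wn] by linarith
    moreover have "card (insert c (f ` (nbhd G w - {u, v}))) \<le> Suc (card (nbhd G w - {u, v}))"
      using finite_nbhd[OF G, of w] card_image_le[of "nbhd G w - {u, v}" f]
      by (simp add: card_insert_if)
    ultimately have less: "card (insert c (f ` (nbhd G w - {u, v}))) < card {..<q}"
      using \<open>d < q\<close> by simp
    have "\<not> {..<q} \<subseteq> insert c (f ` (nbhd G w - {u, v}))"
    proof
      assume "{..<q} \<subseteq> insert c (f ` (nbhd G w - {u, v}))"
      hence "card {..<q} \<le> card (insert c (f ` (nbhd G w - {u, v})))"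
        using finite_nbhd[OF G] by (intro card_mono) auto
      thus False using less by linarith
    qed
    then obtain c' where c': "c' < q" "c' \<noteq> c" "\<And>y. y \<in> nbhd G w \<Longrightarrow> y \<noteq> u \<Longrightarrow> y \<noteq> v \<Longrightarrow> f y \<noteq> c'"
      by fastforce
    define g where "g = f(w := c', u := c, v := c)"
    have gs: "g u = c" "g v = c" "g w = c'" "\<And>y. y \<noteq> u \<Longrightarrow> y \<noteq> v \<Longrightarrow> y \<noteq> w \<Longrightarrow> g y = f y"
      using wne by (simp_all add: g_def)
    have "g \<in> assignments n q"
      using fa uv wn c' \<open>c < q\<close> by (auto simp: g_def assignments_def PiE_iff extensional_def)
    moreover have "g x \<noteq> g y" if e: "{x, y} \<in> G" for x y
    proof -
      have end_uv: "g x \<noteq> g y" if "{x, y} \<in> G" "x = u \<or> x = v" for x y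
      proof -
        have "y \<in> ?M" using that by (auto simp: nbhd_def)
        moreover from this have "y \<noteq> u" "y \<noteq> v" using uvM by metis+
        moreover have "g x = c" using that(2) gs by metis
        ultimately show ?thesis using only[of y] c'(2) gs by (cases "y = w") metis+
      qed
      have end_w: "g w \<noteq> g y" if "{w, y} \<in> G" "y \<noteq> u" "y \<noteq> v" for y
      proof -
        have "y \<in> nbhd G w" "y \<noteq> w" using that graphs_edge(3)[OF G that(1)] by (auto simp: nbhd_def)
        thus ?thesis using c'(3)[of y] that gs by metis
      qed
      have sym: "{y, x} \<in> G" using e by (simp add: insert_commute)
      consider "x = u \<or> x = v" | "y = u \<or> y = v" | "x = w" "y \<noteq> u" "y \<noteq> v"
        | "y = w" "x \<noteq> u" "x \<noteq> v" | "x \<notin> {u, v, w}" "y \<notin> {u, v, w}" by blast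
      then show ?thesis
      proof cases
        case 1 then show ?thesis by (rule end_uv[OF e])
      next
        case 2 then show ?thesis by (rule end_uv[OF sym, symmetric])
      next
        case 3 then show ?thesis using end_w[of y] e by metis
      next
        case 4 then show ?thesis using end_w[of x] sym by metis
      next
        case 5 then show ?thesis using fp[OF e] gs by simp
      qed
    qed
    ultimately have "g \<in> colorings n q G" by (simp add: colorings_def)
    then show ?thesis using uv w wne gs by (intro that[of g w]) (auto simp: g_def fun_eq_iff)
  qed
qed

text \<open>A color that occurs at least twice uses up two elements of \<open>M\<close>, so there
  are at most d such colors.\<close>

lemma card_rare_colors:
  fixes f :: "'a \<Rightarrow> nat"
  assumes "finite M" "card M \<le> 2 * d"
  shows "q - d \<le> card {c \<in> {..<q}. card {w \<in> M. f w = c} \<le> 1}"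
proof -
  define B where "B = {c \<in> {..<q}. \<not> card {w \<in> M. f w = c} \<le> 1}"
  have fB: "finite B" by (simp add: B_def)
  have "2 * card B = (\<Sum>c\<in>B. 2)" by simp
  also have "\<dots> \<le> (\<Sum>c\<in>B. card {w \<in> M. f w = c})"
    by (intro sum_mono) (auto simp: B_def)
  also have "\<dots> = card (\<Union>c\<in>B. {w \<in> M. f w = c})"
    using assms(1) fB by (intro card_UN_disjoint[symmetric]) auto
  also have "\<dots> \<le> card M" using assms(1) by (intro card_mono) auto
  finally have "card B \<le> d" using assms(2) by simp
  moreover have "{c \<in> {..<q}. card {w \<in> M. f w = c} \<le> 1} = {..<q} - B" by (auto simp: B_def)
  moreover have "card ({..<q} - B) = q - card B"
    using fB by (subst card_Diff_subset) (auto simp: B_def)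
  ultimately show ?thesis by simp
qed

lemma card_equal_color:
  assumes G: "G \<in> graphs n d" and "d < q" and uv: "u < n" "v < n" "u \<noteq> v" "{u, v} \<notin> G"
  shows "card (colorings n q G) * (q - d)
    \<le> card {f \<in> colorings n q G. f u = f v} * (q ^ 2 * (2 * d + 1))"
proof -
  define \<Omega> where "\<Omega> = colorings n q G"
  define \<Omega>' where "\<Omega>' = {f \<in> colorings n q G. f u = f v}"
  define M where "M = nbhd G u \<union> nbhd G v"
  define T where "T f = {c \<in> {..<q}. card {w \<in> M. f w = c} \<le> 1}" for f :: "nat \<Rightarrow> nat"
  have fin: "finite \<Omega>" "finite \<Omega>'"
    by (auto simp: \<Omega>_def \<Omega>'_def colorings_def assignments_def finite_PiE)
  have fM: "finite M" using finite_nbhd[OF G] by (simp add: M_def)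
  have cM: "card M \<le> 2 * d"
    using card_nbhd[OF G uv(1)] card_nbhd[OF G uv(2)] card_Un_le[of "nbhd G u" "nbhd G v"]
    by (simp add: M_def)
  define X where "X = \<Omega>' \<times> ({..<q} \<times> {..<q}) \<times> insert u M"
  \<comment> \<open>The decoding map: a coloring \<open>f\<close> and a color \<open>c\<close> rare
    for it are recovered from the recolored \<open>g\<close>, the old colors of \<open>u\<close> and
    \<open>v\<close>, and the freed vertex \<open>w\<close>, whose old color \<open>c\<close> is now
    the color of \<open>u\<close>. For each \<open>g\<close> these data take at most q^2 (2 d + 1)
    values.\<close>
  define \<Psi> where "\<Psi> = (\<lambda>(g :: nat \<Rightarrow> nat, (a, b), w). ((g(w := g u))(u := a, v := b), g u))"
  have "card \<Omega> * (q - d) = (\<Sum>f\<in>\<Omega>. q - d)" by simp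
  also have "\<dots> \<le> (\<Sum>f\<in>\<Omega>. card (T f))"
    unfolding T_def by (intro sum_mono card_rare_colors fM cM)
  also have "\<dots> = card (SIGMA f:\<Omega>. T f)" using fin by (simp add: T_def)
  also have "\<dots> \<le> card X"
  proof (rule surj_card_le)
    show "finite X" using fin fM by (simp add: X_def)
    show "(SIGMA f:\<Omega>. T f) \<subseteq> \<Psi> ` X"
    proof safe
      fix f c assume f: "f \<in> \<Omega>" and c: "c \<in> T f"
      obtain g w where g: "g \<in> colorings n q G" "g u = c" "g v = c"
        "w \<in> insert u (nbhd G u \<union> nbhd G v)" "f = (g(w := c))(u := f u, v := f v)"
        by (rule recoloring_exists[OF G \<open>d < q\<close> uv, of f c])
          (use f c in \<open>auto simp: \<Omega>_def T_def M_def\<close>)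
      have "f u < q" "f v < q"
        using f uv by (auto simp: \<Omega>_def colorings_def assignments_def PiE_iff)
      hence "(g, (f u, f v), w) \<in> X" using g by (simp add: X_def \<Omega>'_def M_def)
      moreover have "\<Psi> (g, (f u, f v), w) = (f, c)" using g(2,5) by (simp add: \<Psi>_def)
      ultimately show "(f, c) \<in> \<Psi> ` X" by (metis imageI)
    qed
  qed
  also have "card X = card \<Omega>' * (q ^ 2 * card (insert u M))"
    by (simp add: X_def card_cartesian_product power2_eq_square)
  also have "\<dots> \<le> card \<Omega>' * (q ^ 2 * (2 * d + 1))"
    using cM fM by (intro mult_left_mono) (auto simp: card_insert_if)
  finally show ?thesis by (simp add: \<Omega>_def \<Omega>'_def)
qed

text \<open>From d + 1 \<le> q follows q \<le> (q - d) (d + 1), which trades q / (q - d) for d + 1.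
  Then (d + 1) (2 d + 1) = 2 d^2 + 3 d + 1 \<le> 6 d^3 for positive d, the origin of the 6.\<close>

lemma equal_color_fraction:
  assumes G: "G \<in> graphs n d" and "0 < d" "d < q" and uv: "u < n" "v < n" "u \<noteq> v" "{u, v} \<notin> G"
  shows "real (card (colorings n q G)) \<le>
    real (card {f \<in> colorings n q G. f u = f v}) * (6 * q * d ^ 3)"
proof -
  have d: "real d \<ge> 1" and q: "real q \<ge> d + 1" using assms by auto
  have "real (card (colorings n q G)) * (q - d)
      \<le> real (card {f \<in> colorings n q G. f u = f v}) * (real q ^ 2 * (2 * d + 1))"
    using card_equal_color[OF G \<open>d < q\<close> uv] \<open>d < q\<close>
    by (metis (no_types, lifting) of_nat_le_iff of_nat_mult of_nat_power)
  moreover have "real q ^ 2 * (2 * d + 1) \<le> real (6 * q * d ^ 3) * real (q - d)"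
  proof -
    have "real q \<le> (real q - d) * (d + 1)"
    proof -
      have "real d * (real d + 1) \<le> real d * real q" using q by (intro mult_left_mono) auto
      thus ?thesis by (simp add: algebra_simps)
    qed
    hence "real q * (2 * d + 1) \<le> ((real q - d) * (d + 1)) * (2 * d + 1)"
      by (intro mult_right_mono) auto
    also have "\<dots> = (real q - d) * ((d + 1) * (2 * d + 1))" by (simp add: algebra_simps)
    also have "\<dots> \<le> (real q - d) * (6 * d ^ 3)"
    proof (intro mult_left_mono)
      have "real d \<le> real d ^ 3" "real d ^ 2 \<le> real d ^ 3" "1 \<le> real d ^ 3"
        using d power_increasing[of 1 3 "real d"] power_increasing[of 2 3 "real d"]
          power_increasing[of 0 3 "real d"] by auto
      moreover have "(real d + 1) * (2 * d + 1) = 2 * real d ^ 2 + 3 * real d + 1"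
        by (simp add: algebra_simps power2_eq_square)
      ultimately show "real ((d + 1) * (2 * d + 1)) \<le> 6 * d ^ 3"
        by (simp only: of_nat_mult of_nat_add of_nat_1 of_nat_numeral of_nat_power)
    qed (use q in simp)
    finally have "real q * (real q * (2 * d + 1)) \<le> real q * ((real q - d) * (6 * d ^ 3))"
      by (intro mult_left_mono) auto
    thus ?thesis using assms by (simp add: power2_eq_square algebra_simps of_nat_diff)
  qed
  hence "real (card {f \<in> colorings n q G. f u = f v}) * (real q ^ 2 * (2 * d + 1)) \<le>
      real (card {f \<in> colorings n q G. f u = f v}) * (real (6 * q * d ^ 3) * real (q - d))"
    by (intro mult_left_mono) auto
  ultimately have "real (card (colorings n q G)) * (q - d) \<le>
      (real (card {f \<in> colorings n q G. f u = f v}) * (6 * q * d ^ 3)) * (q - d)"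
    by (simp only: mult.assoc)
  thus ?thesis using assms by (simp add: of_nat_diff mult_right_le_imp_le)
qed

section \<open>A greedy learner\<close>

text \<open>Total correctness with a clock: \<open>T\<close> is the time already spent and the
  postcondition sees the accumulated time. Sequencing is then plain composition, and the simplifier
  can run straight-line code symbolically.\<close>

definition wp :: "com \<Rightarrow> (state \<Rightarrow> nat \<Rightarrow> bool) \<Rightarrow> state \<Rightarrow> nat \<Rightarrow> bool" where
  "wp c Q s T \<longleftrightarrow> (\<exists>t s'. exec c s t s' \<and> Q s' (T + t))"

inductive_cases exec_ConstE: "exec (Const i k) (r, m) t s'"
inductive_cases exec_AddE: "exec (Add i j k) (r, m) t s'"
inductive_cases exec_LoadE: "exec (Load i j) (r, m) t s'"
inductive_cases exec_StoreE: "exec (Store i j) (r, m) t s'"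
inductive_cases exec_SeqE: "exec (Seq c1 c2) s t s'"
inductive_cases exec_IfE: "exec (IfLess i j c1 c2) (r, m) t s'"

lemma wp_Const [simp]: "wp (Const i k) Q (r, m) T \<longleftrightarrow> Q (r(i := k), m) (T + 1)"
  unfolding wp_def by (auto elim!: exec_ConstE intro!: exI exec.Const)

lemma wp_Add [simp]: "wp (Add i j k) Q (r, m) T \<longleftrightarrow> Q (r(i := r j + r k), m) (T + 1)"
  unfolding wp_def by (auto elim!: exec_AddE intro!: exI exec.Add)

lemma wp_Load [simp]: "wp (Load i j) Q (r, m) T \<longleftrightarrow> Q (r(i := m (r j)), m) (T + 1)"
  unfolding wp_def by (auto elim!: exec_LoadE intro!: exI exec.Load)

lemma wp_Store [simp]: "wp (Store i j) Q (r, m) T \<longleftrightarrow> Q (r, m(r i := r j)) (T + 1)"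
  unfolding wp_def by (auto elim!: exec_StoreE intro!: exI exec.Store)

lemma wp_Seq [simp]: "wp (Seq c1 c2) Q s T \<longleftrightarrow> wp c1 (wp c2 Q) s T"
proof -
  have "wp c1 (wp c2 Q) s T" if "wp (Seq c1 c2) Q s T"
    using that unfolding wp_def by (metis exec_SeqE add.assoc)
  moreover have "wp (Seq c1 c2) Q s T" if "wp c1 (wp c2 Q) s T"
    using that unfolding wp_def by (metis exec.Seq add.assoc)
  ultimately show ?thesis by blast
qed

lemma wp_IfLess [simp]:
  "wp (IfLess i j c1 c2) Q (r, m) T \<longleftrightarrow>
    (if r i < r j then wp c1 Q (r, m) (T + 1) else wp c2 Q (r, m) (T + 1))"
proof -
  have "wp (IfLess i j c1 c2) Q (r, m) T" if "r i < r j" "wp c1 Q (r, m) (T + 1)"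
    using that exec.IfTrue[of r i j c1 m] unfolding wp_def by (metis add.assoc)
  moreover have "wp (IfLess i j c1 c2) Q (r, m) T" if "\<not> r i < r j" "wp c2 Q (r, m) (T + 1)"
    using that exec.IfFalse[of r i j c2 m] unfolding wp_def by (metis add.assoc)
  moreover have "if r i < r j then wp c1 Q (r, m) (T + 1) else wp c2 Q (r, m) (T + 1)"
    if "wp (IfLess i j c1 c2) Q (r, m) T"
    using that unfolding wp_def by (auto elim!: exec_IfE) (metis add_Suc_right add_Suc)+
  ultimately show ?thesis by (cases "r i < r j") auto
qed

lemma wp_mono: "wp c Q s T \<Longrightarrow> (\<And>s' T'. Q s' T' \<Longrightarrow> Q' s' T') \<Longrightarrow> wp c Q' s T"
  unfolding wp_def by blast

text \<open>A rule for counted loops: the invariant is indexed by the number of completed rounds,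
  which also proves termination after exactly \<open>K\<close> rounds. Each round costs at most
  \<open>B\<close> plus one guard, and the failing guard is the final 1.\<close>

lemma wp_While:
  assumes "Inv 0 s"
    and step: "\<And>k r m T. k < K \<Longrightarrow> Inv k (r, m) \<Longrightarrow>
      r i < r j \<and> wp c (\<lambda>s' T'. Inv (Suc k) s' \<and> T' \<le> T + B) (r, m) T"
    and exit: "\<And>r m. Inv K (r, m) \<Longrightarrow> \<not> r i < r j"
    and post: "\<And>s' T'. Inv K s' \<Longrightarrow> T' \<le> T + K * (B + 1) + 1 \<Longrightarrow> Q s' T'"
  shows "wp (WhileLess i j c) Q s T"
proof -
  \<comment> \<open>Induction on the number \<open>l\<close> of rounds still to be run.\<close>
  have "\<exists>t s'. exec (WhileLess i j c) s t s' \<and> Inv K s' \<and> t \<le> l * (B + 1) + 1"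
    if "Inv (K - l) s" "l \<le> K" for l s
    using that
  proof (induction l arbitrary: s)
    case 0
    obtain r m where s: "s = (r, m)" by (cases s)
    have "exec (WhileLess i j c) s 1 s" using 0 exit unfolding s by (intro exec.WhileFalse) auto
    then show ?case using 0 by fastforce
  next
    case (Suc l)
    obtain r m where s: "s = (r, m)" by (cases s)
    have eq: "Suc (K - Suc l) = K - l" using Suc.prems by simp
    have st: "r i < r j \<and> wp c (\<lambda>s' T'. Inv (Suc (K - Suc l)) s' \<and> T' \<le> 0 + B) (r, m) 0"
      using Suc.prems by (intro step) (auto simp: s)
    then obtain t1 s1 where 1: "exec c (r, m) t1 s1" "Inv (K - l) s1" "t1 \<le> B"
      unfolding eq by (auto simp: wp_def)
    obtain t2 s2 where 2: "exec (WhileLess i j c) s1 t2 s2" "Inv K s2" "t2 \<le> l * (B + 1) + 1"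
      using Suc.IH[OF 1(2)] Suc.prems by auto
    have "exec (WhileLess i j c) s (1 + t1 + t2) s2"
      unfolding s using st 1 2 by (intro exec.WhileTrue) auto
    moreover have "1 + t1 + t2 \<le> Suc l * (B + 1) + 1" using 1 2 by simp
    ultimately show ?case using 2 by blast
  qed
  from this[of K s] assms(1) obtain t s' where "exec (WhileLess i j c) s t s'" "Inv K s'"
    "t \<le> K * (B + 1) + 1" by auto
  thus ?thesis unfolding wp_def using post[of s' "T + t"] by (intro exI[of _ t] exI[of _ s']) auto
qed

section \<open>The learning program\<close>

abbreviation (input) seq (infixr ";;" 60) where "c1 ;; c2 \<equiv> Seq c1 c2"

text \<open>Registers: 4 holds the constant 1, 5 the address of the output matrix, 6 and 7 the current
  vertices \<open>u\<close> and \<open>v\<close>, 8 and 9 the addresses of their colors in the current sample, 12 whether equal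
  colors have been seen, 13 to 15 the addresses of the matrix entries \<open>(u, u)\<close>, \<open>(v, v)\<close> and \<open>(u, v)\<close>,
  16 holds \<open>n + 1\<close>, and 17 is never written. The diagonal of the matrix, which is not read as
  output, stores the degrees of the graph built so far.\<close>

definition skip :: com where "skip = Const 18 0"

text \<open>Equality of two colors is the failure of both strict comparisons. Adding n, held in
  register 0, moves both addresses to the same vertices in the next sample.\<close>

definition scan :: com where
  "scan = Load 10 8 ;; Load 11 9 ;;
     IfLess 10 11 skip (IfLess 11 10 skip (Const 12 1)) ;; Add 8 8 0 ;; Add 9 9 0"

text \<open>With 1 in register 4, the guard \<open>IfLess 12 4\<close> is a test for zero. The
  degrees on the diagonal make the degree check a constant-time operation.\<close>

definition insert_edge :: com where
  "insert_edge = IfLess 12 4 (Load 10 13 ;; Load 11 14 ;;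
     IfLess 10 2 (IfLess 11 2
       (Add 10 10 4 ;; Add 11 11 4 ;; Store 13 10 ;; Store 14 11 ;; Store 15 4) skip) skip) skip"

text \<open>Adding register 17, which is 0, copies a register. Adding n + 1 to an address moves it
  along the diagonal, adding 1 moves it to the next column.\<close>

definition handle_pair :: com where
  "handle_pair = Const 12 0 ;; Add 8 6 17 ;; Add 9 7 17 ;; WhileLess 8 5 scan ;; insert_edge ;;
     Add 7 7 4 ;; Add 14 14 16 ;; Add 15 15 4"

definition handle_vertex :: com where
  "handle_vertex = Add 7 6 4 ;; Add 14 13 16 ;; Add 15 13 4 ;; WhileLess 7 0 handle_pair ;;
     Add 6 6 4 ;; Add 13 13 16"

text \<open>The outer guard makes the running time constant when there are no samples, as a bound of
  the form C (L n^2 + 1) demands. The first loop forms L * n by repeated addition, since the machine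
  does not multiply.\<close>

definition learner :: com where
  "learner = IfLess 17 3
     (Const 4 1 ;; WhileLess 6 3 (Add 5 5 0 ;; Add 6 6 4) ;; Add 16 0 4 ;; Const 6 0 ;;
      Add 13 5 17 ;; WhileLess 6 0 handle_vertex)
     skip"

section \<open>The greedy graph, independently of the machine\<close>

definition never_equal :: "nat \<Rightarrow> (nat \<Rightarrow> nat) list \<Rightarrow> nat set set" where
  "never_equal n xs = {{u, v} | u v. u < v \<and> v < n \<and> (\<forall>x\<in>set xs. x u \<noteq> x v)}"

definition deg :: "nat set set \<Rightarrow> nat \<Rightarrow> nat" where
  "deg E v = card {e \<in> E. v \<in> e}"

text \<open>\<open>greedy n d xs E u v\<close>: the graph \<open>E\<close> is a valid state of the greedy construction after all pairs
  lexicographically below \<open>(u, v)\<close> have been handled.\<close>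

definition greedy :: "nat \<Rightarrow> nat \<Rightarrow> (nat \<Rightarrow> nat) list \<Rightarrow> nat set set \<Rightarrow> nat \<Rightarrow> nat \<Rightarrow> bool" where
  "greedy n d xs E u v \<longleftrightarrow> E \<in> graphs n d \<and> E \<subseteq> never_equal n xs \<and>
     (\<forall>a b. a < b \<longrightarrow> {a, b} \<in> E \<longrightarrow> a < u \<or> a = u \<and> b < v) \<and>
     (never_equal n xs \<in> graphs n d \<longrightarrow>
       (\<forall>a b. a < b \<longrightarrow> b < n \<longrightarrow> a < u \<or> a = u \<and> b < v \<longrightarrow> {a, b} \<in> never_equal n xs \<longrightarrow> {a, b} \<in> E))"

lemma mem_never_equal:
  assumes "u < v"
  shows "{u, v} \<in> never_equal n xs \<longleftrightarrow> v < n \<and> (\<forall>x\<in>set xs. x u \<noteq> x v)"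
proof
  assume "{u, v} \<in> never_equal n xs"
  then obtain a b where "{u, v} = {a, b}" "a < b" "b < n" "\<forall>x\<in>set xs. x a \<noteq> x b"
    unfolding never_equal_def by blast
  thus "v < n \<and> (\<forall>x\<in>set xs. x u \<noteq> x v)" using assms by (auto simp: doubleton_eq_iff)
next
  assume "v < n \<and> (\<forall>x\<in>set xs. x u \<noteq> x v)"
  thus "{u, v} \<in> never_equal n xs" using assms unfolding never_equal_def by blast
qed

lemma deg_insert:
  assumes "finite E" "{u, v} \<notin> E"
  shows "deg (insert {u, v} E) w = (if w = u \<or> w = v then Suc (deg E w) else deg E w)"
proof -
  have "{e \<in> insert {u, v} E. w \<in> e} =
      (if w = u \<or> w = v then insert {u, v} {e \<in> E. w \<in> e} else {e \<in> E. w \<in> e})" by auto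
  thus ?thesis using assms by (simp add: deg_def)
qed

lemma deg_le: "E \<in> graphs n d \<Longrightarrow> w < n \<Longrightarrow> deg E w \<le> d"
  unfolding graphs_def deg_def by blast

lemma greedy_insert:
  assumes E: "greedy n d xs E u v" and uv: "u < v" "v < n" "{u, v} \<in> never_equal n xs"
    and deg: "deg E u < d" "deg E v < d"
  shows "greedy n d xs (insert {u, v} E) u (Suc v)"
proof -
  have EG: "E \<in> graphs n d" and sub: "E \<subseteq> never_equal n xs" using E by (auto simp: greedy_def)
  have new: "{u, v} \<notin> E" using E uv unfolding greedy_def by blast
  have "deg (insert {u, v} E) w \<le> d" if "w < n" for w
    using deg deg_le[OF EG that] deg_insert[OF finite_graph[OF EG] new, of w] by auto
  moreover have "insert {u, v} E \<subseteq> [{..<n}]\<^bsup>2\<^esup>"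
    using EG uv unfolding graphs_def by simp
  ultimately have "insert {u, v} E \<in> graphs n d" unfolding graphs_def deg_def by blast
  moreover have "a < u \<or> a = u \<and> b < Suc v" if "a < b" "{a, b} \<in> insert {u, v} E" for a b
  proof (cases "{a, b} \<in> E")
    case True
    hence "a < u \<or> a = u \<and> b < v" using E that(1) unfolding greedy_def by blast
    then show ?thesis by auto
  next
    case False
    then show ?thesis using that uv by (auto simp: doubleton_eq_iff)
  qed
  moreover have "{a, b} \<in> insert {u, v} E"
    if "never_equal n xs \<in> graphs n d" "a < b" "b < n" "a < u \<or> a = u \<and> b < Suc v"
      "{a, b} \<in> never_equal n xs" for a b
  proof (cases "a = u \<and> b = v")
    case False
    hence "a < u \<or> a = u \<and> b < v" using that(4) by linarith
    then show ?thesis using E that unfolding greedy_def by blast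
  qed simp
  ultimately show ?thesis using sub uv(3) unfolding greedy_def by blast
qed

text \<open>Rejecting a pair for its degree cannot lose an edge when \<open>never_equal n xs\<close>
  itself respects the degree bound: \<open>E\<close> together with the pair is still contained in
  it, so both endpoints have a free slot.\<close>

lemma greedy_skip:
  assumes E: "greedy n d xs E u v" and uv: "u < v" "v < n"
    and skip: "{u, v} \<notin> never_equal n xs \<or> d \<le> deg E u \<or> d \<le> deg E v"
  shows "greedy n d xs E u (Suc v)"
proof -
  have EG: "E \<in> graphs n d" and sub: "E \<subseteq> never_equal n xs" using E by (auto simp: greedy_def)
  have new: "{u, v} \<notin> E" using E uv unfolding greedy_def by blast
  have no: "{u, v} \<notin> never_equal n xs" if NE: "never_equal n xs \<in> graphs n d"
  proof
    assume e: "{u, v} \<in> never_equal n xs"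
    have "Suc (deg E w) \<le> d" if "w = u \<or> w = v" for w
    proof -
      have "Suc (deg E w) = deg (insert {u, v} E) w"
        using that by (simp add: deg_insert[OF finite_graph[OF EG] new])
      also have "\<dots> \<le> deg (never_equal n xs) w"
        unfolding deg_def using sub e finite_graph[OF NE] by (intro card_mono) auto
      also have "\<dots> \<le> d" using that uv by (intro deg_le[OF NE]) auto
      finally show ?thesis .
    qed
    thus False using skip e by fastforce
  qed
  have "a < u \<or> a = u \<and> b < Suc v" if "a < b" "{a, b} \<in> E" for a b
  proof -
    have "a < u \<or> a = u \<and> b < v" using E that unfolding greedy_def by blast
    thus ?thesis by auto
  qed
  moreover have "{a, b} \<in> E"
    if "never_equal n xs \<in> graphs n d" "a < b" "b < n" "a < u \<or> a = u \<and> b < Suc v"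
      "{a, b} \<in> never_equal n xs" for a b
  proof -
    have "\<not> (a = u \<and> b = v)" using no that by blast
    hence "a < u \<or> a = u \<and> b < v" using that(4) by linarith
    then show ?thesis using E that unfolding greedy_def by blast
  qed
  ultimately show ?thesis using EG sub unfolding greedy_def by blast
qed

text \<open>The end of row u is the start of row u + 1, whose first pair above the diagonal is (u +
  1, u + 2).\<close>

lemma greedy_next:
  assumes "greedy n d xs E u n"
  shows "greedy n d xs E (Suc u) (Suc (Suc u))"
proof -
  have "E \<in> graphs n d" "E \<subseteq> never_equal n xs" using assms by (auto simp: greedy_def)
  moreover have "a < Suc u \<or> a = Suc u \<and> b < Suc (Suc u)" if "a < b" "{a, b} \<in> E" for a b
  proof -
    have "a < u \<or> a = u \<and> b < n" using assms that unfolding greedy_def by blast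
    thus ?thesis by auto
  qed
  moreover have "{a, b} \<in> E"
    if "never_equal n xs \<in> graphs n d" "a < b" "b < n" "a < Suc u \<or> a = Suc u \<and> b < Suc (Suc u)"
      "{a, b} \<in> never_equal n xs" for a b
  proof -
    have "a < u \<or> a = u \<and> b < n" using that by linarith
    thus ?thesis using assms that unfolding greedy_def by blast
  qed
  ultimately show ?thesis unfolding greedy_def by blast
qed

lemma greedy_empty: "greedy n d xs {} 0 (Suc 0)"
  by (auto simp: greedy_def graphs_def)

section \<open>Memory layout, loop invariants and step counts\<close>

lemma matrix_address_eq:
  fixes u v u' v' n :: nat
  assumes "v < n" "v' < n"
  shows "u * n + v = u' * n + v' \<longleftrightarrow> u = u' \<and> v = v'"
proof
  assume *: "u * n + v = u' * n + v'"
  have "(u * n + v) div n = u" "(u' * n + v') div n = u'" using assms by auto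
  with * show "u = u' \<and> v = v'" by auto
qed simp

definition represents ::
    "nat \<Rightarrow> (nat \<Rightarrow> nat) list \<Rightarrow> nat set set \<Rightarrow> (nat \<Rightarrow> nat) \<Rightarrow> bool" where
  "represents n xs E m \<longleftrightarrow>
     (\<forall>i<length xs. \<forall>v<n. m (v + i * n) = (xs ! i) v) \<and>
     (\<forall>u v. u \<le> v \<longrightarrow> v < n \<longrightarrow> m (length xs * n + u * n + v) =
        (if u = v then deg E u else if {u, v} \<in> E then 1 else 0))"

lemma represents_insert:
  assumes m: "represents n xs E m" and "finite E" "{u, v} \<notin> E" "u < v" "v < n"
  shows "represents n xs (insert {u, v} E)
    (m(length xs * n + u * n + u := Suc (deg E u), length xs * n + v * n + v := Suc (deg E v),
       length xs * n + u * n + v := 1))"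
proof -
  have below: "w + i * n < length xs * n" if "i < length xs" "w < n" for i w
  proof -
    have "w + i * n < (i + 1) * n" using that by simp
    also have "\<dots> \<le> length xs * n" using that by (intro mult_right_mono) auto
    finally show ?thesis .
  qed
  have eq: "length xs * n + a * n + b = length xs * n + a' * n + b' \<longleftrightarrow> a = a' \<and> b = b'"
    if "b < n" "b' < n" for a b a' b'
    using matrix_address_eq[OF that] by (simp add: add.assoc)
  let ?m = "m(length xs * n + u * n + u := Suc (deg E u), length xs * n + v * n + v := Suc (deg E v),
       length xs * n + u * n + v := 1)"
  have "?m (w + i * n) = (xs ! i) w" if "i < length xs" "w < n" for i w
    using below[OF that] m that by (auto simp: represents_def)
  moreover have "?m (length xs * n + a * n + b) =
      (if a = b then deg (insert {u, v} E) a else if {a, b} \<in> insert {u, v} E then 1 else 0)"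
    if "a \<le> b" "b < n" for a b
  proof -
    have old: "m (length xs * n + a * n + b) =
        (if a = b then deg E a else if {a, b} \<in> E then 1 else 0)"
      using m that unfolding represents_def by blast
    have "{a, b} = {u, v} \<longleftrightarrow> a = u \<and> b = v" using that assms by (auto simp: doubleton_eq_iff)
    thus ?thesis using old that assms
      by (auto simp: fun_upd_apply eq deg_insert)
  qed
  ultimately show ?thesis unfolding represents_def by blast
qed

definition frame :: "nat set \<Rightarrow> (nat \<Rightarrow> nat) \<Rightarrow> (nat \<Rightarrow> nat) \<Rightarrow> bool" where
  "frame A r r' \<longleftrightarrow> (\<forall>x. x \<notin> A \<longrightarrow> r' x = r x)"

text \<open>The address in register 8 doubles as the loop counter: u + k * n lies below the start L
  * n of the matrix exactly for k < L. A round takes at most 7 steps and one guard.\<close>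

lemma wp_scan_loop:
  assumes "represents n xs E m" "u < v" "v < n"
    and r: "r 0 = n" "r 5 = length xs * n" "r 8 = u" "r 9 = v" "r 12 = 0"
    and post: "\<And>r' T'. frame {8, 9, 10, 11, 12, 18} r r' \<Longrightarrow>
      (r' 12 = 0 \<longleftrightarrow> {u, v} \<in> never_equal n xs) \<Longrightarrow> T' \<le> T + 8 * length xs + 1 \<Longrightarrow> Q (r', m) T'"
  shows "wp (WhileLess 8 5 scan) Q (r, m) T"
proof (rule wp_While[where K="length xs" and B=7 and Inv="\<lambda>k (r', m'). m' = m \<and>
    frame {8, 9, 10, 11, 12, 18} r r' \<and> r' 8 = u + k * n \<and> r' 9 = v + k * n \<and>
    (r' 12 = 0 \<longleftrightarrow> (\<forall>i<k. (xs ! i) u \<noteq> (xs ! i) v))"])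
  show "case (r, m) of (r', m') \<Rightarrow> m' = m \<and>
    frame {8, 9, 10, 11, 12, 18} r r' \<and> r' 8 = u + 0 * n \<and> r' 9 = v + 0 * n \<and>
    (r' 12 = 0 \<longleftrightarrow> (\<forall>i<0. (xs ! i) u \<noteq> (xs ! i) v))"
    using r by (simp add: frame_def)
next
  fix k r' m' T assume k: "k < length xs" and inv: "case (r', m') of (r', m') \<Rightarrow> m' = m \<and>
    frame {8, 9, 10, 11, 12, 18} r r' \<and> r' 8 = u + k * n \<and> r' 9 = v + k * n \<and>
    (r' 12 = 0 \<longleftrightarrow> (\<forall>i<k. (xs ! i) u \<noteq> (xs ! i) v))"
  have f: "frame {8, 9, 10, 11, 12, 18} r r'" and m': "m' = m" using inv by auto
  have r': "r' 0 = n" "r' 5 = length xs * n" "r' 8 = u + k * n" "r' 9 = v + k * n"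
    using inv r by (auto simp: frame_def)
  have 12: "r' 12 = 0 \<longleftrightarrow> (\<forall>i<k. (xs ! i) u \<noteq> (xs ! i) v)" using inv by auto
  have "u + k * n < (k + 1) * n" using assms by simp
  also have "\<dots> \<le> length xs * n" using k by (intro mult_right_mono) auto
  finally have "r' 8 < r' 5" using r' by simp
  moreover have "m (u + k * n) = (xs ! k) u" "m (v + k * n) = (xs ! k) v"
    using assms k by (auto simp: represents_def)
  ultimately show "r' 8 < r' 5 \<and> wp scan (\<lambda>s' T'. (case s' of (r', m') \<Rightarrow> m' = m \<and>
    frame {8, 9, 10, 11, 12, 18} r r' \<and> r' 8 = u + Suc k * n \<and> r' 9 = v + Suc k * n \<and>
    (r' 12 = 0 \<longleftrightarrow> (\<forall>i<Suc k. (xs ! i) u \<noteq> (xs ! i) v))) \<and> T' \<le> T + 7) (r', m') T"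
    using f 12 by (auto simp: scan_def skip_def r' m' frame_def less_Suc_eq)
next
  fix r' m' assume "case (r', m') of (r', m') \<Rightarrow> m' = m \<and>
    frame {8, 9, 10, 11, 12, 18} r r' \<and> r' 8 = u + length xs * n \<and> r' 9 = v + length xs * n \<and>
    (r' 12 = 0 \<longleftrightarrow> (\<forall>i<length xs. (xs ! i) u \<noteq> (xs ! i) v))"
  thus "\<not> r' 8 < r' 5" using r by (simp add: frame_def)
next
  fix s' T' assume inv: "case s' of (r', m') \<Rightarrow> m' = m \<and>
    frame {8, 9, 10, 11, 12, 18} r r' \<and> r' 8 = u + length xs * n \<and> r' 9 = v + length xs * n \<and>
    (r' 12 = 0 \<longleftrightarrow> (\<forall>i<length xs. (xs ! i) u \<noteq> (xs ! i) v))"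
    and T': "T' \<le> T + length xs * (7 + 1) + 1"
  obtain r' where s': "s' = (r', m)" using inv by (cases s') auto
  show "Q s' T'" unfolding s'
  proof (rule post)
    show "r' 12 = 0 \<longleftrightarrow> {u, v} \<in> never_equal n xs"
      using inv assms(3) mem_never_equal[OF assms(2)] by (simp add: s' all_set_conv_all_nth)
  qed (use inv T' in \<open>auto simp: s'\<close>)
qed


definition base :: "nat \<Rightarrow> nat \<Rightarrow> nat \<Rightarrow> (nat \<Rightarrow> nat) \<Rightarrow> bool" where
  "base n d L r \<longleftrightarrow> r 0 = n \<and> r 2 = d \<and> r 3 = L \<and> r 4 = 1 \<and> r 5 = L * n \<and> r 16 = n + 1 \<and> r 17 = 0"

definition pair_inv ::
    "nat \<Rightarrow> nat \<Rightarrow> (nat \<Rightarrow> nat) list \<Rightarrow> nat \<Rightarrow> nat \<Rightarrow> state \<Rightarrow> bool" where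
  "pair_inv n d xs u v = (\<lambda>(r, m). base n d (length xs) r \<and> r 6 = u \<and> r 7 = v \<and>
     r 13 = length xs * n + u * n + u \<and> r 14 = length xs * n + v * n + v \<and>
     r 15 = length xs * n + u * n + v \<and>
     (\<exists>E. greedy n d xs E u v \<and> represents n xs E m))"

text \<open>Besides 8 steps per sample there are at most 17: 3 initializations, the last guard of
  the scan, 10 in \<open>insert_edge\<close> and 3 increments. The 20 leaves some slack.\<close>

lemma wp_handle_pair:
  assumes inv: "pair_inv n d xs u v (r, m)" and uv: "u < v" "v < n"
  shows "wp handle_pair (\<lambda>s' T'. pair_inv n d xs u (Suc v) s' \<and> T' \<le> T + (8 * length xs + 20)) (r, m) T"
proof -
  obtain E where E: "greedy n d xs E u v" "represents n xs E m"
    using inv by (auto simp: pair_inv_def)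
  have EG: "E \<in> graphs n d" using E by (simp add: greedy_def)
  have new: "{u, v} \<notin> E" using E(1) uv unfolding greedy_def by blast
  let ?r = "r(12 := 0, 8 := u, 9 := v)"
  have r: "r 0 = n" "r 2 = d" "r 3 = length xs" "r 4 = 1" "r 5 = length xs * n" "r 16 = n + 1"
    "r 17 = 0" "r 6 = u" "r 7 = v" "r 13 = length xs * n + u * n + u"
    "r 14 = length xs * n + v * n + v" "r 15 = length xs * n + u * n + v"
    using inv by (auto simp: pair_inv_def base_def)
  have deg: "m (length xs * n + u * n + u) = deg E u" "m (length xs * n + v * n + v) = deg E v"
    using E(2) uv unfolding represents_def by auto
  have ne: "length xs * n + u * n + u \<noteq> length xs * n + v * n + v"
    using matrix_address_eq[of u n v u v] uv by auto
  have "wp (WhileLess 8 5 scan) (wp (insert_edge ;; Add 7 7 4 ;; Add 14 14 16 ;; Add 15 15 4)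
      (\<lambda>s' T'. pair_inv n d xs u (Suc v) s' \<and> T' \<le> T + (8 * length xs + 20))) (?r, m) (Suc (Suc (Suc T)))"
  proof (rule wp_scan_loop[OF E(2) uv])
    fix r' T' assume f: "frame {8, 9, 10, 11, 12, 18} ?r r'"
      and flag: "r' 12 = 0 \<longleftrightarrow> {u, v} \<in> never_equal n xs" and T': "T' \<le> Suc (Suc (Suc T)) + 8 * length xs + 1"
    have r': "r' 0 = n" "r' 2 = d" "r' 3 = length xs" "r' 4 = 1" "r' 5 = length xs * n"
      "r' 16 = n + 1" "r' 17 = 0" "r' 6 = u" "r' 7 = v" "r' 13 = length xs * n + u * n + u"
      "r' 14 = length xs * n + v * n + v" "r' 15 = length xs * n + u * n + v"
      using f r by (auto simp: frame_def)
    show "wp (insert_edge ;; Add 7 7 4 ;; Add 14 14 16 ;; Add 15 15 4)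
      (\<lambda>s' T'. pair_inv n d xs u (Suc v) s' \<and> T' \<le> T + (8 * length xs + 20)) (r', m) T'"
    proof (cases "{u, v} \<in> never_equal n xs \<and> deg E u < d \<and> deg E v < d")
      case True
      have "represents n xs (insert {u, v} E) (m(length xs * n + u * n + u := Suc (deg E u),
          length xs * n + v * n + v := Suc (deg E v), length xs * n + u * n + v := 1))"
        by (rule represents_insert[OF E(2) finite_graph[OF EG] new uv])
      moreover have "greedy n d xs (insert {u, v} E) u (Suc v)"
        using greedy_insert[OF E(1) uv] True by blast
      ultimately show ?thesis using True T' flag
        by (auto simp: insert_edge_def skip_def r' deg pair_inv_def base_def)
    next
      case False
      hence "greedy n d xs E u (Suc v)" by (intro greedy_skip[OF E(1) uv]) auto
      with False show ?thesis using T' flag E(2)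
        by (auto simp: insert_edge_def skip_def r' deg pair_inv_def base_def)
    qed
  qed (use r in auto)
  thus ?thesis by (simp add: handle_pair_def r)
qed

definition vertex_inv :: "nat \<Rightarrow> nat \<Rightarrow> (nat \<Rightarrow> nat) list \<Rightarrow> nat \<Rightarrow> state \<Rightarrow> bool" where
  "vertex_inv n d xs u = (\<lambda>(r, m). base n d (length xs) r \<and> r 6 = u \<and>
     r 13 = length xs * n + u * n + u \<and>
     (\<exists>E. greedy n d xs E u (Suc u) \<and> represents n xs E m))"

lemma wp_handle_vertex:
  assumes inv: "vertex_inv n d xs u (r, m)" and "u < n"
  shows "wp handle_vertex (\<lambda>s' T'. vertex_inv n d xs (Suc u) s' \<and>
    T' \<le> T + (n * (8 * length xs + 21) + 6)) (r, m) T"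
proof -
  let ?r = "r(7 := Suc u, 14 := length xs * n + Suc u * n + Suc u, 15 := length xs * n + u * n + Suc u)"
  have r: "r 0 = n" "r 4 = 1" "r 16 = n + 1" "r 6 = u" "r 13 = length xs * n + u * n + u"
    using inv by (auto simp: vertex_inv_def base_def)
  have start: "pair_inv n d xs u (Suc u + 0) (?r, m)"
    using inv by (auto simp: vertex_inv_def pair_inv_def base_def)
  have "wp (WhileLess 7 0 handle_pair) (wp (Add 6 6 4 ;; Add 13 13 16)
    (\<lambda>s' T'. vertex_inv n d xs (Suc u) s' \<and> T' \<le> T + (n * (8 * length xs + 21) + 6))) (?r, m) (Suc (Suc (Suc T)))"
  proof (rule wp_While[where K="n - Suc u" and B="8 * length xs + 20" and
        Inv="\<lambda>k. pair_inv n d xs u (Suc u + k)", OF start])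
    fix k r m T assume k: "k < n - Suc u" and inv: "pair_inv n d xs u (Suc u + k) (r, m)"
    have "r 7 < r 0" using k inv by (auto simp: pair_inv_def base_def)
    thus "r 7 < r 0 \<and> wp handle_pair (\<lambda>s' T'. pair_inv n d xs u (Suc u + Suc k) s' \<and>
        T' \<le> T + (8 * length xs + 20)) (r, m) T"
      using wp_handle_pair[OF inv] k by auto
  next
    fix r m assume "pair_inv n d xs u (Suc u + (n - Suc u)) (r, m)"
    thus "\<not> r 7 < r 0" using \<open>u < n\<close> by (auto simp: pair_inv_def base_def)
  next
    fix s' T' assume inv: "pair_inv n d xs u (Suc u + (n - Suc u)) s'"
      and T': "T' \<le> Suc (Suc (Suc T)) + (n - Suc u) * (8 * length xs + 20 + 1) + 1"
    obtain r' m' where s': "s' = (r', m')" by (cases s')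
    have r': "r' 6 = u" "r' 4 = 1" "r' 13 = length xs * n + u * n + u" "r' 16 = n + 1"
      "base n d (length xs) r'"
      using inv by (auto simp: s' pair_inv_def base_def)
    obtain E where "greedy n d xs E u n" "represents n xs E m'"
      using inv \<open>u < n\<close> by (auto simp: s' pair_inv_def)
    hence E: "greedy n d xs E (Suc u) (Suc (Suc u))" "represents n xs E m'"
      using greedy_next by auto
    have "(n - Suc u) * (8 * length xs + 20 + 1) \<le> n * (8 * length xs + 21)"
      by (intro mult_mono) auto
    thus "wp (Add 6 6 4 ;; Add 13 13 16) (\<lambda>s' T'. vertex_inv n d xs (Suc u) s' \<and>
        T' \<le> T + (n * (8 * length xs + 21) + 6)) s' T'"
      using r' T' E by (auto simp: s' vertex_inv_def base_def)
  qed
  thus ?thesis by (simp add: handle_vertex_def r algebra_simps)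
qed

lemma wp_vertex_loop:
  assumes "vertex_inv n d xs 0 (r, m)"
  shows "wp (WhileLess 6 0 handle_vertex) (\<lambda>s' T'. vertex_inv n d xs n s' \<and>
    T' \<le> T + n * (n * (8 * length xs + 21) + 7) + 1) (r, m) T"
proof (rule wp_While[where K=n and B="n * (8 * length xs + 21) + 6" and Inv="vertex_inv n d xs", OF assms])
  fix k r m T assume k: "k < n" and inv: "vertex_inv n d xs k (r, m)"
  have "r 6 < r 0" using k inv by (auto simp: vertex_inv_def base_def)
  thus "r 6 < r 0 \<and> wp handle_vertex (\<lambda>s' T'. vertex_inv n d xs (Suc k) s' \<and>
      T' \<le> T + (n * (8 * length xs + 21) + 6)) (r, m) T"
    using wp_handle_vertex[OF inv k] by simp
next
  fix r m assume "vertex_inv n d xs n (r, m)"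
  thus "\<not> r 6 < r 0" by (auto simp: vertex_inv_def base_def)
qed (simp add: algebra_simps)

lemma represents_init:
  assumes "1 \<le> n"
  shows "represents n xs {} (snd (init_state n q d xs))"
proof -
  have "v + i * n < length xs * n" if "i < length xs" "v < n" for i v
  proof -
    have "v + i * n < (i + 1) * n" using that by simp
    also have "\<dots> \<le> length xs * n" using that by (intro mult_right_mono) auto
    finally show ?thesis .
  qed
  thus ?thesis by (auto simp: represents_def init_state_def deg_def)
qed

lemma wp_base_loop:
  assumes r: "r 0 = n" "r 3 = L" "r 4 = 1" "r 5 = 0" "r 6 = 0"
    and post: "\<And>r' T'. frame {5, 6} r r' \<Longrightarrow> r' 5 = L * n \<Longrightarrow> T' \<le> T + 3 * L + 1 \<Longrightarrow> Q (r', m) T'"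
  shows "wp (WhileLess 6 3 (Add 5 5 0 ;; Add 6 6 4)) Q (r, m) T"
proof (rule wp_While[where K=L and B=2 and
      Inv="\<lambda>k (r', m'). m' = m \<and> frame {5, 6} r r' \<and> r' 5 = k * n \<and> r' 6 = k"])
  fix s' T' assume *: "case s' of (r', m') \<Rightarrow> m' = m \<and> frame {5, 6} r r' \<and> r' 5 = L * n \<and> r' 6 = L"
    and "T' \<le> T + L * (2 + 1) + 1"
  obtain r' where "s' = (r', m)" using * by (cases s') auto
  thus "Q s' T'" using * \<open>T' \<le> _\<close> by (auto intro!: post)
qed (use r in \<open>auto simp: frame_def\<close>)

lemma wp_learner:
  assumes "1 \<le> n" "xs \<noteq> []"
  shows "wp learner (\<lambda>s' T'. vertex_inv n d xs n s' \<and> T' \<le> 60 * (length xs * n ^ 2))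
    (init_state n q d xs) 0"
proof -
  let ?L = "length xs"
  obtain r m where init: "init_state n q d xs = (r, m)" by (cases "init_state n q d xs")
  have m: "represents n xs {} m" using represents_init[OF assms(1), of xs q d] by (simp add: init)
  have r: "r 0 = n" "r 2 = d" "r 3 = ?L" "r 5 = 0" "r 6 = 0" "r 17 = 0"
    using init by (auto simp: init_state_def)
  have L: "1 \<le> ?L" using assms(2) by (cases xs) auto
  \<comment> \<open>As 1 \<le> L and 1 \<le> n, every summand is absorbed into L n^2, with
    coefficients adding up to 49.\<close>
  have bound: "3 * ?L + n * (n * (8 * ?L + 21) + 7) + 10 \<le> 60 * (?L * n ^ 2)"
  proof -
    have nn: "1 \<le> n ^ 2" "n \<le> n ^ 2" using assms(1) by (simp_all add: power2_eq_square)
    have "?L * 1 \<le> ?L * n ^ 2" "1 * n ^ 2 \<le> ?L * n ^ 2"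
      using nn L by (intro mult_mono; simp)+
    moreover have "n * (n * (8 * ?L + 21) + 7) = 8 * (?L * n ^ 2) + 21 * n ^ 2 + 7 * n"
      by (simp add: power2_eq_square algebra_simps)
    ultimately show ?thesis using nn by linarith
  qed
  have "wp (WhileLess 6 3 (Add 5 5 0 ;; Add 6 6 4))
     (wp (Add 16 0 4 ;; Const 6 0 ;; Add 13 5 17 ;; WhileLess 6 0 handle_vertex)
       (\<lambda>s' T'. vertex_inv n d xs n s' \<and> T' \<le> 60 * (?L * n ^ 2))) (r(4 := 1), m) (Suc (Suc 0))"
  proof (rule wp_base_loop)
    fix r' T' assume f: "frame {5, 6} (r(4 := 1)) r'" and r'5: "r' 5 = ?L * n"
      and T': "T' \<le> Suc (Suc 0) + 3 * ?L + 1"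
    have r': "r' 0 = n" "r' 2 = d" "r' 3 = ?L" "r' 17 = 0" "r' 4 = 1"
      using f r by (auto simp: frame_def)
    let ?r = "r'(16 := n + 1, 6 := 0, 13 := ?L * n)"
    have "vertex_inv n d xs 0 (?r, m)"
      using m greedy_empty[of n d xs] by (auto simp: vertex_inv_def base_def r' r'5)
    from wp_vertex_loop[OF this, of "Suc (Suc (Suc T'))"]
    have "wp (WhileLess 6 0 handle_vertex) (\<lambda>s' T'. vertex_inv n d xs n s' \<and> T' \<le> 60 * (?L * n ^ 2))
        (?r, m) (Suc (Suc (Suc T')))"
      by (rule wp_mono) (use T' bound in auto)
    thus "wp (Add 16 0 4 ;; Const 6 0 ;; Add 13 5 17 ;; WhileLess 6 0 handle_vertex)
       (\<lambda>s' T'. vertex_inv n d xs n s' \<and> T' \<le> 60 * (?L * n ^ 2)) (r', m) T'"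
      by (simp add: r' r'5)
  qed (use r in auto)
  thus ?thesis using assms(2) by (simp add: learner_def init r)
qed

lemma output_graph_represents:
  assumes "represents n xs E m" "E \<in> graphs n d"
  shows "output_graph n (length xs) (r, m) = E"
proof
  show "output_graph n (length xs) (r, m) \<subseteq> E"
  proof
    fix e assume "e \<in> output_graph n (length xs) (r, m)"
    then obtain u v where e: "e = {u, v}" "u < v" "v < n" "m (length xs * n + u * n + v) \<noteq> 0"
      unfolding output_graph_def by auto
    moreover have "m (length xs * n + u * n + v) = (if {u, v} \<in> E then 1 else 0)"
      using assms(1) e unfolding represents_def by simp
    ultimately show "e \<in> E" by (simp split: if_splits)
  qed
  show "E \<subseteq> output_graph n (length xs) (r, m)"
  proof
    fix e assume e: "e \<in> E"
    obtain u v where uv: "e = {u, v}" "u < v" "v < n"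
      by (rule graph_edge_cases[OF assms(2) e])
    have "m (length xs * n + u * n + v) = 1"
      using assms(1) e uv unfolding represents_def by simp
    thus "e \<in> output_graph n (length xs) (r, m)" using uv unfolding output_graph_def by auto
  qed
qed

lemma greedy_complete:
  assumes "E \<in> graphs n d" "E \<subseteq> never_equal n xs" "never_equal n xs \<in> graphs n d"
    and "greedy n d xs E n (Suc n)"
  shows "E = never_equal n xs"
proof
  show "never_equal n xs \<subseteq> E"
  proof
    fix e assume e: "e \<in> never_equal n xs"
    then obtain u v where "e = {u, v}" "u < v" "v < n" unfolding never_equal_def by blast
    thus "e \<in> E" using assms(3,4) e unfolding greedy_def by auto
  qed
qed fact

text \<open>For L = 0 the program stops at its first guard and the untouched memory is read as the
  empty graph. For positive L the function \<open>F\<close> is chosen list by list from the final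
  invariant, and is exact whenever \<open>never_equal\<close> lies in the family.\<close>

lemma learner_computes:
  assumes "1 \<le> n"
  obtains F where "computes learner n q d L (60 * (real L * real n ^ 2 + 1)) F"
    and "\<And>xs. xs \<in> sample_lists n q L \<Longrightarrow> F xs \<in> graphs n d"
    and "\<And>xs. xs \<in> sample_lists n q L \<Longrightarrow> 0 < L \<Longrightarrow> never_equal n xs \<in> graphs n d \<Longrightarrow>
      F xs = never_equal n xs"
    and "\<And>xs. L = 0 \<Longrightarrow> F xs = {}"
proof (cases "L = 0")
  case True
  have *: "computes learner n q d L (60 * (real L * real n ^ 2 + 1)) (\<lambda>_. {})"
    unfolding computes_def
  proof
    fix xs assume "xs \<in> sample_lists n q L"
    hence xs: "xs = []" using True by (simp add: sample_lists_def)
    obtain r m where init: "init_state n q d xs = (r, m)" by (cases "init_state n q d xs")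
    have r: "r 3 = 0" "m = (\<lambda>_. 0)" using init xs by (auto simp: init_state_def)
    have "wp learner (\<lambda>s T. T \<le> 2 \<and> snd s = m) (r, m) 0"
      by (simp add: learner_def skip_def r)
    then obtain t s where "exec learner (r, m) t s" "t \<le> 2" "snd s = m" by (auto simp: wp_def)
    thus "\<exists>t s. exec learner (init_state n q d xs) t s \<and> real t \<le> 60 * (real L * real n ^ 2 + 1) \<and>
        output_graph n L s = {}"
      using True by (intro exI[of _ t] exI[of _ s]) (auto simp: init output_graph_def r)
  qed
  show ?thesis by (rule that[OF *]) (use True in \<open>auto simp: graphs_def\<close>)
next
  case False
  have "\<exists>E. (\<exists>t s. exec learner (init_state n q d xs) t s \<and>
      real t \<le> 60 * (real L * real n ^ 2 + 1) \<and> output_graph n L s = E) \<and> E \<in> graphs n d \<and>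
      (never_equal n xs \<in> graphs n d \<longrightarrow> E = never_equal n xs)"
    if "xs \<in> sample_lists n q L" for xs
  proof -
    have len: "length xs = L" using that by (simp add: sample_lists_def)
    hence "xs \<noteq> []" using False by auto
    from wp_learner[OF assms this, of d q] obtain t s where ts: "exec learner (init_state n q d xs) t s"
      "vertex_inv n d xs n s" "t \<le> 60 * (L * n ^ 2)"
      by (auto simp: wp_def len)
    obtain r m where s: "s = (r, m)" by (cases s)
    obtain E where E: "greedy n d xs E n (Suc n)" "represents n xs E m"
      using ts(2) by (auto simp: s vertex_inv_def)
    have E': "E \<in> graphs n d" "E \<subseteq> never_equal n xs" using E(1) by (auto simp: greedy_def)
    have "real t \<le> real (60 * (L * n ^ 2))" using ts(3) by (simp only: of_nat_le_iff)
    hence "real t \<le> 60 * (real L * real n ^ 2 + 1)" by simp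
    moreover have "output_graph n L s = E"
      using output_graph_represents[OF E(2) E'(1)] by (simp add: s len)
    ultimately show ?thesis using ts(1) E' greedy_complete[OF E' _ E(1)] by blast
  qed
  then obtain F where F: "\<And>xs. xs \<in> sample_lists n q L \<Longrightarrow> (\<exists>t s. exec learner (init_state n q d xs) t s \<and>
      real t \<le> 60 * (real L * real n ^ 2 + 1) \<and> output_graph n L s = F xs) \<and> F xs \<in> graphs n d \<and>
      (never_equal n xs \<in> graphs n d \<longrightarrow> F xs = never_equal n xs)"
    by metis
  show ?thesis
    by (rule that[of F]) (use F False in \<open>auto simp: computes_def\<close>)
qed

datatype vertex = Clique bool nat nat | Indep bool nat nat | Joint nat | Leaf nat

section \<open>Two chains of forced colors\<close>

lemma transpose_eq_transpose_iff:
  "Transposition.transpose a b c = Transposition.transpose a b d \<longleftrightarrow> c = d"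
  by (metis transpose_involutory)

text \<open>Each of the two chains (\<open>s = True, False\<close>) alternates cliques \<open>Clique s j\<close> on \<open>q - 1\<close> vertices and
  independent sets \<open>Indep s j\<close>, whose vertices are all forced to the one color missing on the clique.
  Every vertex of the next clique has one neighbor in \<open>Indep s j\<close>, which forces the same color onto
  \<open>Indep s (Suc j)\<close>. A vertex of \<open>Indep s j\<close> has \<open>q - 1\<close> neighbors in its own clique, at most \<open>t\<close> in the
  next one, and one more slot, so that its degree is at most \<open>q + t\<close> although the chain as a whole
  behaves like one vertex of unbounded degree. \<open>Joint j\<close> is joined to both chains; \<open>Leaf j\<close> is
  joined to one of them, and \<open>S\<close> tells to which.\<close>

definition verts :: "nat \<Rightarrow> nat \<Rightarrow> nat \<Rightarrow> vertex set" where
  "verts q t N = {Clique s j a | s j a. j < N \<and> a < q - 1} \<union> {Indep s j b | s j b. j < N \<and> b \<le> t} \<union>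
     Joint ` {..<N} \<union> Leaf ` {..<N}"

text \<open>The division \<open>a div t\<close> cuts the next clique into blocks of t consecutive
  vertices, one block for each independent vertex. \<open>Joint\<close> and \<open>Leaf\<close> hang
  from the different indices 0 and 1, so that no independent vertex carries both; in
  \<open>IZ\<close> the side \<open>s\<close> is free, so both chains are linked to
  \<open>Joint j\<close>.\<close>

inductive link :: "nat \<Rightarrow> nat \<Rightarrow> nat \<Rightarrow> nat set \<Rightarrow> vertex \<Rightarrow> vertex \<Rightarrow> bool" for q t N S where
  KK: "j < N \<Longrightarrow> a < b \<Longrightarrow> b < q - 1 \<Longrightarrow> link q t N S (Clique s j a) (Clique s j b)"
| KI: "j < N \<Longrightarrow> a < q - 1 \<Longrightarrow> b \<le> t \<Longrightarrow> link q t N S (Clique s j a) (Indep s j b)"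
| IK: "Suc j < N \<Longrightarrow> a < q - 1 \<Longrightarrow> link q t N S (Indep s j (a div t)) (Clique s (Suc j) a)"
| IZ: "j < N \<Longrightarrow> link q t N S (Indep s j 0) (Joint j)"
| IW: "j < N \<Longrightarrow> link q t N S (Indep (j \<in> S) j 1) (Leaf j)"

lemma card_verts:
  assumes "1 \<le> q"
  shows "finite (verts q t N)" "card (verts q t N) \<le> N * (2 * (q + t) + 2)"
proof -
  have eq: "verts q t N = (\<lambda>(s, j, a). Clique s j a) ` (UNIV \<times> {..<N} \<times> {..<q - 1}) \<union>
     (\<lambda>(s, j, b). Indep s j b) ` (UNIV \<times> {..<N} \<times> {..t}) \<union> Joint ` {..<N} \<union> Leaf ` {..<N}"
    (is "_ = ?A \<union> ?B \<union> ?C \<union> ?D")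
    by (auto simp: verts_def image_iff)
  show "finite (verts q t N)" unfolding eq by simp
  have "card (?A \<union> ?B \<union> ?C \<union> ?D) \<le> card ?A + card ?B + card ?C + card ?D"
    by (meson add_le_mono1 card_Un_le order_trans)
  also have "card ?A \<le> 2 * N * (q - 1)"
    by (rule order_trans[OF card_image_le]) (auto simp: card_cartesian_product)
  also have "card ?B \<le> 2 * N * (t + 1)"
    by (rule order_trans[OF card_image_le]) (auto simp: card_cartesian_product)
  also have "card ?C \<le> N" by (rule order_trans[OF card_image_le]) auto
  also have "card ?D \<le> N" by (rule order_trans[OF card_image_le]) auto
  finally have "card (verts q t N) \<le> 2 * N * (q - 1) + 2 * N * (t + 1) + N + N"
    unfolding eq by simp
  also have "\<dots> = N * (2 * (q + t) + 2)"
    using assms by (cases q) (auto simp: algebra_simps)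
  finally show "card (verts q t N) \<le> N * (2 * (q + t) + 2)" .
qed

text \<open>Here the quadratic condition is used: t + 1 blocks of size t exhaust a clique on q - 1
  vertices.\<close>

lemma div_le_quotient:
  fixes a t q :: nat
  assumes "a < q - 1" "q - 1 \<le> t * (t + 1)"
  shows "a div t \<le> t"
proof -
  have "a < (t + 1) * t" using assms by (simp add: mult.commute)
  hence "a div t < t + 1" by (rule less_mult_imp_div_less)
  thus ?thesis by simp
qed

lemma link_verts:
  assumes "link q t N S x y" "q - 1 \<le> t * (t + 1)" "1 \<le> t"
  shows "x \<in> verts q t N \<and> y \<in> verts q t N \<and> x \<noteq> y"
  using assms(1)
proof cases
  case (IK j a s)
  then show ?thesis using div_le_quotient[OF _ assms(2), of a] by (auto simp: verts_def)
qed (use assms in \<open>auto simp: verts_def\<close>)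

definition nbrs :: "nat \<Rightarrow> nat \<Rightarrow> nat \<Rightarrow> nat set \<Rightarrow> vertex \<Rightarrow> vertex set" where
  "nbrs q t N S x = {y. link q t N S x y \<or> link q t N S y x}"

inductive_simps link_simps:
  "link q t N S (Clique s j a) y" "link q t N S x (Clique s j a)"
  "link q t N S (Indep s j a) y" "link q t N S x (Indep s j a)"
  "link q t N S (Joint j) y" "link q t N S x (Joint j)"
  "link q t N S (Leaf j) y" "link q t N S x (Leaf j)"

lemma card_nbrs:
  assumes "x \<in> verts q t N" "3 \<le> q" "1 \<le> t"
  shows "finite (nbrs q t N S x) \<and> card (nbrs q t N S x) \<le> q + t"
proof -
  have "\<exists>Y. finite Y \<and> nbrs q t N S x \<subseteq> Y \<and> card Y \<le> q + t"
  proof (cases x)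
    case (Clique s j a)
    \<comment> \<open>The sizes are q - 2, t + 1 and 1. On level 0 there is no previous level; the
      truncated j - 1 then only contributes a harmless element to this superset.\<close>
    let ?Y = "Clique s j ` ({..<q - 1} - {a}) \<union> Indep s j ` {..t} \<union> {Indep s (j - 1) (a div t)}"
    have "nbrs q t N S x \<subseteq> ?Y" unfolding Clique by (auto simp: nbrs_def link_simps)
    moreover have "card ?Y \<le> q + t"
    proof -
      have "card ?Y \<le> card (Clique s j ` ({..<q - 1} - {a})) + card (Indep s j ` {..t}) + card {Indep s (j - 1) (a div t)}"
        by (meson add_le_mono1 card_Un_le order_trans)
      also have "\<dots> \<le> card ({..<q - 1} - {a}) + card {..t} + 1"
        by (intro add_mono card_image_le) auto
      also have "\<dots> = q + t" using assms Clique by (auto simp: verts_def)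
      finally show ?thesis .
    qed
    ultimately show ?thesis by (intro exI[of _ ?Y]) auto
  next
    case (Indep s j b)
    \<comment> \<open>The sizes are q - 1, at most t, and 1. For b above 1 nothing hangs from the
      vertex and the last element is just part of the superset.\<close>
    let ?Y = "Clique s j ` {..<q - 1} \<union> Clique s (Suc j) ` {a. a div t = b} \<union> {if b = 0 then Joint j else Leaf j}"
    have block: "{a. a div t = b} \<subseteq> {b * t..<b * t + t}"
      using assms(3) dividend_less_div_times[of t] by (auto simp: add.commute)
    hence fin: "finite {a. a div t = b}" by (rule finite_subset) simp
    have "card {a. a div t = b} \<le> card {b * t..<b * t + t}" using block by (intro card_mono) auto
    hence c: "card {a. a div t = b} \<le> t" by simp
    have "nbrs q t N S x \<subseteq> ?Y" unfolding Indep by (auto simp: nbrs_def link_simps)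
    moreover have "card ?Y \<le> q + t"
    proof -
      have "card ?Y \<le> card (Clique s j ` {..<q - 1}) + card (Clique s (Suc j) ` {a. a div t = b}) +
          card {if b = 0 then Joint j else Leaf j}"
        by (meson add_le_mono1 card_Un_le order_trans)
      also have "\<dots> \<le> card {..<q - 1} + card {a. a div t = b} + 1"
        using fin by (intro add_mono card_image_le) auto
      also have "\<dots> \<le> q + t" using assms c by simp
      finally show ?thesis .
    qed
    ultimately show ?thesis using fin by (intro exI[of _ ?Y]) auto
  next
    case (Joint j)
    have "nbrs q t N S x \<subseteq> {Indep True j 0, Indep False j 0}"
      unfolding Joint by (auto simp: nbrs_def link_simps)
    then show ?thesis using assms by (intro exI[of _ "{Indep True j 0, Indep False j 0}"]) auto
  next
    case (Leaf j)
    have "nbrs q t N S x \<subseteq> {Indep (j \<in> S) j 1}"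
      unfolding Leaf by (auto simp: nbrs_def link_simps)
    then show ?thesis using assms by (intro exI[of _ "{Indep (j \<in> S) j 1}"]) auto
  qed
  thus ?thesis by (meson card_mono finite_subset order_trans)
qed

text \<open>An arbitrary injection replaces an explicit numbering. Vertices outside its image are
  isolated, so one construction serves every sufficiently large n.\<close>

locale chains =
  fixes n q t N :: nat and enc :: "vertex \<Rightarrow> nat"
  assumes q: "3 \<le> q" and t: "1 \<le> t" and qt: "q - 1 \<le> t * (t + 1)" and N: "1 \<le> N"
    and inj: "inj_on enc (verts q t N)" and enc: "enc ` verts q t N \<subseteq> {..<n}"
begin

abbreviation "V \<equiv> verts q t N"

definition graph :: "nat set \<Rightarrow> nat set set" where
  "graph S = {{enc x, enc y} | x y. link q t N S x y}"

lemma linkD: "link q t N S x y \<Longrightarrow> x \<in> V \<and> y \<in> V \<and> x \<noteq> y"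
  using link_verts qt t by blast

lemma enc_eq: "x \<in> V \<Longrightarrow> y \<in> V \<Longrightarrow> enc x = enc y \<longleftrightarrow> x = y"
  using inj by (auto simp: inj_on_def)

lemma graph_in_graphs: "graph S \<in> graphs n (q + t)"
proof -
  have "graph S \<subseteq> [{..<n}]\<^bsup>2\<^esup>"
  proof
    fix e assume "e \<in> graph S"
    then obtain x y where e: "e = {enc x, enc y}" "link q t N S x y" unfolding graph_def by blast
    have "enc x \<noteq> enc y" "enc x \<in> {..<n}" "enc y \<in> {..<n}"
      using linkD[OF e(2)] enc enc_eq by auto
    thus "e \<in> [{..<n}]\<^bsup>2\<^esup>" using e(1) by simp
  qed
  moreover have "card {e \<in> graph S. v \<in> e} \<le> q + t" for v
  proof (cases "v \<in> enc ` V")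
    case True
    then obtain x where x: "x \<in> V" "v = enc x" by blast
    have "{e \<in> graph S. v \<in> e} \<subseteq> (\<lambda>y. {enc x, enc y}) ` nbrs q t N S x"
    proof
      fix e assume "e \<in> {e \<in> graph S. v \<in> e}"
      then obtain a b where e: "e = {enc a, enc b}" "link q t N S a b" "v \<in> e"
        unfolding graph_def by blast
      have "x = a \<or> x = b" using e(1,3) linkD[OF e(2)] x enc_eq by auto
      thus "e \<in> (\<lambda>y. {enc x, enc y}) ` nbrs q t N S x"
      proof
        assume "x = a"
        thus ?thesis using e by (intro image_eqI[of _ _ b]) (auto simp: nbrs_def)
      next
        assume "x = b"
        thus ?thesis using e by (intro image_eqI[of _ _ a]) (auto simp: nbrs_def)
      qed
    qed
    hence "card {e \<in> graph S. v \<in> e} \<le> card (nbrs q t N S x)"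
      using card_nbrs[OF x(1) q t] by (intro surj_card_le) auto
    thus ?thesis using card_nbrs[OF x(1) q t, of S] by linarith
  next
    case False
    have "v \<notin> e" if e: "e \<in> graph S" for e
    proof -
      obtain x y where "e = {enc x, enc y}" "link q t N S x y" using e unfolding graph_def by blast
      thus ?thesis using linkD False by blast
    qed
    hence "{e \<in> graph S. v \<in> e} = {}" by blast
    thus ?thesis by (metis card.empty zero_le)
  qed
  ultimately show ?thesis unfolding graphs_def by blast
qed

section \<open>Colorings of the chain graphs\<close>

lemma colorings_graph:
  "f \<in> colorings n q (graph S) \<longleftrightarrow>
    f \<in> assignments n q \<and> (\<forall>x y. link q t N S x y \<longrightarrow> f (enc x) \<noteq> f (enc y))"
proof
  assume "f \<in> colorings n q (graph S)"
  thus "f \<in> assignments n q \<and> (\<forall>x y. link q t N S x y \<longrightarrow> f (enc x) \<noteq> f (enc y))"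
    unfolding colorings_def graph_def by blast
next
  assume f: "f \<in> assignments n q \<and> (\<forall>x y. link q t N S x y \<longrightarrow> f (enc x) \<noteq> f (enc y))"
  have "f u \<noteq> f v" if uv: "{u, v} \<in> graph S" for u v
  proof -
    obtain x y where xy: "{u, v} = {enc x, enc y}" "link q t N S x y"
      using uv unfolding graph_def by blast
    have "f (enc x) \<noteq> f (enc y)" using f xy(2) by blast
    thus ?thesis using xy(1) by (auto simp: doubleton_eq_iff)
  qed
  thus "f \<in> colorings n q (graph S)" using f unfolding colorings_def by blast
qed

lemma color_less: "f \<in> colorings n q (graph S) \<Longrightarrow> x \<in> V \<Longrightarrow> f (enc x) < q"
  using enc unfolding colorings_graph assignments_def by (fastforce simp: PiE_iff)

definition chain_color :: "bool \<Rightarrow> (nat \<Rightarrow> nat) \<Rightarrow> nat" where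
  "chain_color s f = f (enc (Indep s 0 0))"

lemma unique_free_color:
  assumes f: "f \<in> colorings n q (graph S)" and "j < N"
  obtains c where "{..<q} - (\<lambda>a. f (enc (Clique s j a))) ` {..<q - 1} = {c}"
proof -
  let ?g = "\<lambda>a. f (enc (Clique s j a))"
  have Clique: "Clique s j a \<in> V" if "a < q - 1" for a using that \<open>j < N\<close> by (auto simp: verts_def)
  have "?g a \<noteq> ?g b" if "a < b" "b < q - 1" for a b
    using f that \<open>j < N\<close> link.KK unfolding colorings_graph by blast
  hence "inj_on ?g {..<q - 1}"
    by (intro inj_onI) (metis lessThan_iff linorder_neqE_nat)
  hence "card (?g ` {..<q - 1}) = q - 1" by (simp add: card_image)
  moreover have "?g ` {..<q - 1} \<subseteq> {..<q}" using color_less[OF f Clique] by auto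
  ultimately have "card ({..<q} - ?g ` {..<q - 1}) = 1"
    using q by (subst card_Diff_subset) auto
  thus ?thesis using that by (rule card_1_singletonE)
qed

lemma chain_color:
  assumes f: "f \<in> colorings n q (graph S)" and "j < N" "b \<le> t"
  shows "f (enc (Indep s j b)) = chain_color s f"
  using assms(2,3)
proof (induction j arbitrary: b)
  have free: "f (enc (Indep s j b)) \<in> {..<q} - (\<lambda>a. f (enc (Clique s j a))) ` {..<q - 1}"
    if "j < N" "b \<le> t" for j b
  proof -
    have "Indep s j b \<in> V" using that by (auto simp: verts_def)
    moreover have "f (enc (Clique s j a)) \<noteq> f (enc (Indep s j b))" if "a < q - 1" for a
      using f that \<open>j < N\<close> \<open>b \<le> t\<close> link.KI unfolding colorings_graph by blast
    ultimately show ?thesis using color_less[OF f] by (fastforce simp: image_iff)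
  qed
  {
    case 0
    obtain c where "{..<q} - (\<lambda>a. f (enc (Clique s 0 a))) ` {..<q - 1} = {c}"
      using unique_free_color[OF f 0(1)] by blast
    moreover from this have "f (enc (Indep s 0 b)) \<in> {c}" "f (enc (Indep s 0 0)) \<in> {c}"
      using free[of 0 b] free[of 0 0] 0 by (metis le0)+
    ultimately show ?case unfolding chain_color_def by simp
  next
    case (Suc j)
    have "chain_color s f \<noteq> f (enc (Clique s (Suc j) a))" if "a < q - 1" for a
    proof -
      have "f (enc (Indep s j (a div t))) \<noteq> f (enc (Clique s (Suc j) a))"
        using f that Suc.prems link.IK unfolding colorings_graph by blast
      thus ?thesis using Suc.IH[of "a div t"] Suc.prems div_le_quotient[OF that qt] by simp
    qed
    moreover have "chain_color s f < q"
      unfolding chain_color_def using N by (intro color_less[OF f]) (auto simp: verts_def)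
    ultimately have "chain_color s f \<in> {..<q} - (\<lambda>a. f (enc (Clique s (Suc j) a))) ` {..<q - 1}" by auto
    moreover obtain c where c: "{..<q} - (\<lambda>a. f (enc (Clique s (Suc j) a))) ` {..<q - 1} = {c}"
      using unique_free_color[OF f Suc.prems(1)] by blast
    ultimately have "chain_color s f = c" by blast
    moreover have "f (enc (Indep s (Suc j) b)) \<in> {c}" using c free[OF Suc.prems] by metis
    ultimately show ?case by simp
  }
qed

text \<open>The new color may depend on the abstract vertex and on its old color. Isolated vertices
  outside the image keep their color, so that no information about them is lost when recolorings are
  counted.\<close>

definition recolor :: "(vertex \<Rightarrow> nat \<Rightarrow> nat) \<Rightarrow> (nat \<Rightarrow> nat) \<Rightarrow> nat \<Rightarrow> nat" where
  "recolor \<phi> f v = (if v \<in> enc ` V then \<phi> (the_inv_into V enc v) (f v) else f v)"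

lemma recolor_enc: "x \<in> V \<Longrightarrow> recolor \<phi> f (enc x) = \<phi> x (f (enc x))"
  by (simp add: recolor_def the_inv_into_f_f[OF inj])

lemma recolor_assignments:
  assumes f: "f \<in> assignments n q" and \<phi>: "\<And>x c. x \<in> V \<Longrightarrow> c < q \<Longrightarrow> \<phi> x c < q"
  shows "recolor \<phi> f \<in> assignments n q"
proof -
  have "recolor \<phi> f v < q" if "v < n" for v
  proof (cases "v \<in> enc ` V")
    case True
    then obtain x where "x \<in> V" "v = enc x" by blast
    thus ?thesis using f that by (auto simp: recolor_enc \<phi> assignments_def PiE_iff)
  next
    case False
    then show ?thesis using f that by (auto simp: recolor_def assignments_def PiE_iff)
  qed
  moreover have "recolor \<phi> f v = undefined" if "\<not> v < n" for v
    using f enc that by (auto simp: recolor_def assignments_def PiE_iff extensional_def)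
  ultimately show ?thesis by (auto simp: assignments_def PiE_iff extensional_def)
qed

text \<open>A coloring in which the chains disagree: the cliques of the first miss color 0, those of
  the second miss color 1. \<open>Joint\<close> takes the third color 2, and each
  \<open>Leaf\<close> takes the color of the chain from which it does not hang.\<close>

definition rare_coloring :: "nat set \<Rightarrow> nat \<Rightarrow> nat" where
  "rare_coloring S = recolor (\<lambda>x _. case x of
     Clique s j a \<Rightarrow> if s then a + 1 else if a = 0 then 0 else a + 1
   | Indep s j b \<Rightarrow> if s then 0 else 1
   | Joint j \<Rightarrow> 2
   | Leaf j \<Rightarrow> if j \<in> S then 1 else 0) (restrict (\<lambda>_. 0) {..<n})"

lemma rare_coloring:
  "rare_coloring S \<in> colorings n q (graph S)"
proof -
  have "rare_coloring S \<in> assignments n q"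
    unfolding rare_coloring_def using q
    by (intro recolor_assignments)
      (auto simp: assignments_def verts_def split: vertex.splits)
  moreover have "rare_coloring S (enc x) \<noteq> rare_coloring S (enc y)" if "link q t N S x y" for x y
    using that linkD[OF that] unfolding rare_coloring_def
    by (cases rule: link.cases) (auto simp: recolor_enc)
  ultimately show ?thesis by (simp add: colorings_graph)
qed

text \<open>At an index where the two sets differ, the leaf hangs in the other graph from precisely
  the chain whose color it has.\<close>

lemma rare_coloring_other:
  assumes "S \<subseteq> {..<N}" "S' \<subseteq> {..<N}" "S \<noteq> S'"
  shows "rare_coloring S \<notin> colorings n q (graph S')"
proof
  assume *: "rare_coloring S \<in> colorings n q (graph S')"
  obtain j where j: "j < N" "(j \<in> S) \<noteq> (j \<in> S')" using assms by blast
  have a: "link q t N S' (Indep (j \<in> S') j 1) (Leaf j)" using j(1) by (rule link.IW)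
  have "rare_coloring S (enc (Indep (j \<in> S') j 1)) = rare_coloring S (enc (Leaf j))"
    using j(2) linkD[OF a] by (auto simp: rare_coloring_def recolor_enc)
  thus False using * a unfolding colorings_graph by blast
qed

lemma colorings_graph_inj:
  "S \<subseteq> {..<N} \<Longrightarrow> S' \<subseteq> {..<N} \<Longrightarrow> S \<noteq> S' \<Longrightarrow> colorings n q (graph S) \<noteq> colorings n q (graph S')"
  using rare_coloring rare_coloring_other by metis

text \<open>\<open>graph {}\<close> is an arbitrary representative: by \<open>common_eq\<close>
  every \<open>S\<close> gives the same set, because a leaf cannot tell the chains apart when they
  agree.\<close>

definition common :: "(nat \<Rightarrow> nat) set" where
  "common = {f \<in> colorings n q (graph {}). chain_color True f = chain_color False f}"

lemma common_eq: "common = {f \<in> colorings n q (graph S). chain_color True f = chain_color False f}"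
proof -
  have "f \<in> colorings n q (graph S')"
    if f: "f \<in> colorings n q (graph S)" and eq: "chain_color True f = chain_color False f" for f S S'
  proof -
    have "f (enc x) \<noteq> f (enc y)" if a: "link q t N S' x y" for x y
      using a
    proof cases
      case (IW j)
      have "f (enc (Indep (j \<in> S) j 1)) \<noteq> f (enc (Leaf j))"
        using f IW link.IW[of j N q t S] unfolding colorings_graph by blast
      moreover have "f (enc (Indep s j 1)) = chain_color True f" for s
        using chain_color[OF f IW(3) t, of s] eq by (cases s) auto
      ultimately show ?thesis using IW by simp
    qed (use f link.intros[of _ N] in \<open>auto simp: colorings_graph\<close>)
    thus ?thesis using f unfolding colorings_graph by blast
  qed
  thus ?thesis unfolding common_def by blast
qed

text \<open>Recoloring that gives both chains the color of the first one: the colors \<open>a\<close> and \<open>b\<close> are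
  exchanged on the second chain and on the vertices hanging from it, and the vertices \<open>Joint j\<close>, which are
  linked to both chains, receive the colors \<open>h j\<close>.\<close>

definition merge_colors ::
    "nat set \<Rightarrow> nat \<Rightarrow> nat \<Rightarrow> (nat \<Rightarrow> nat) \<Rightarrow> vertex \<Rightarrow> nat \<Rightarrow> nat" where
  "merge_colors S a b h x c = (case x of
     Clique s j i \<Rightarrow> if s then c else Transposition.transpose a b c
   | Indep s j i \<Rightarrow> if s then c else Transposition.transpose a b c
   | Joint j \<Rightarrow> h j
   | Leaf j \<Rightarrow> if j \<in> S then c else Transposition.transpose a b c)"

text \<open>Exchanging two colors keeps all links inside the second part proper, and each leaf is
  treated like the chain it hangs from. Only \<open>Joint\<close> vertices are linked to both parts;
  their links are proper because both chains now show the first color, which \<open>h\<close>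
  avoids.\<close>

lemma merge_colors_coloring:
  assumes f: "f \<in> colorings n q (graph S)" and h: "\<And>j. j < N \<Longrightarrow> h j < q \<and> h j \<noteq> chain_color True f"
  defines "g \<equiv> recolor (merge_colors S (chain_color True f) (chain_color False f) h) f"
  shows "g \<in> colorings n q (graph S)" "chain_color True g = chain_color True f"
    "chain_color False g = chain_color True f"
proof -
  have V0: "Indep s 0 0 \<in> V" for s using N by (auto simp: verts_def)
  have less: "chain_color s f < q" for s
    unfolding chain_color_def by (rule color_less[OF f V0])
  show "chain_color True g = chain_color True f" "chain_color False g = chain_color True f"
    by (simp_all add: g_def chain_color_def recolor_enc[OF V0] merge_colors_def)
  have "g \<in> assignments n q"
    unfolding g_def using f h less
    by (intro recolor_assignments)
      (auto simp: colorings_graph merge_colors_def verts_def Transposition.transpose_def split: vertex.splits)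
  moreover have "g (enc x) \<noteq> g (enc y)" if a: "link q t N S x y" for x y
  proof -
    have ne: "f (enc x) \<noteq> f (enc y)" using f a unfolding colorings_graph by blast
    have xy: "x \<in> V" "y \<in> V" using linkD[OF a] by auto
    from a show ?thesis
    proof cases
      case (IZ j s)
      have "f (enc (Indep s j 0)) = chain_color s f" using chain_color[OF f IZ(3)] by simp
      hence "g (enc x) = chain_color True f"
        using xy by (cases s) (simp_all add: g_def recolor_enc IZ merge_colors_def)
      moreover have "g (enc y) = h j" using xy by (simp add: g_def recolor_enc IZ merge_colors_def)
      ultimately show ?thesis using h[OF IZ(3)] by simp
    qed (use ne xy in \<open>auto simp: g_def recolor_enc merge_colors_def transpose_eq_transpose_iff\<close>)
  qed
  ultimately show "g \<in> colorings n q (graph S)" by (simp add: colorings_graph)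
qed

text \<open>\<open>\<Phi>\<close> injects pairs of a coloring with different chain colors and N new
  \<open>Joint\<close> colors, each avoiding one color, into triples of a merged coloring, the old
  color of the second chain and the N old \<open>Joint\<close> colors, each avoiding two. So
  disagreement costs a factor (q - 2) / (q - 1) per \<open>Joint\<close> vertex, and the choice of
  the second color gives back only q - 1.\<close>

lemma card_rare:
  "card (colorings n q (graph S) - common) * (q - 1) ^ N \<le> card common * ((q - 1) * (q - 2) ^ N)"
proof -
  define B where "B = colorings n q (graph S) - common"
  define a where "a f = chain_color True f" for f
  define b where "b f = chain_color False f" for f
  define X where "X = (SIGMA f:B. {..<N} \<rightarrow>\<^sub>E ({..<q} - {a f}))"
  define Y where "Y = (SIGMA g:common. SIGMA c:{..<q} - {a g}. {..<N} \<rightarrow>\<^sub>E ({..<q} - {a g, c}))"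
  define \<Phi> where "\<Phi> = (\<lambda>(f, h). (recolor (merge_colors S (a f) (b f) h) f,
    b f, restrict (\<lambda>j. f (enc (Joint j))) {..<N}))"
  have fin: "finite (colorings n q E)" for E
    by (simp add: colorings_def assignments_def finite_PiE)
  have finB: "finite B" "finite common" by (simp_all add: B_def common_def fin)
  have B: "f \<in> colorings n q (graph S)" "a f \<noteq> b f" if "f \<in> B" for f
    using that common_eq[of S] by (auto simp: B_def a_def b_def)
  have V0: "Indep s 0 0 \<in> V" for s using N by (auto simp: verts_def)
  have less: "a f < q" "b f < q" if "f \<in> colorings n q (graph S')" for f S'
    unfolding a_def b_def chain_color_def by (intro color_less[OF that] V0)+
  have cP: "card ({..<N} \<rightarrow>\<^sub>E ({..<q} - C)) = (q - card C) ^ N" if "C \<subseteq> {..<q}" "finite C" for C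
    using that by (simp add: card_PiE card_Diff_subset)
  have cX: "card X = card B * (q - 1) ^ N"
  proof -
    have "card X = (\<Sum>f\<in>B. card ({..<N} \<rightarrow>\<^sub>E ({..<q} - {a f})))"
      unfolding X_def using finB by (intro card_SigmaI) (auto intro: finite_PiE)
    also have "\<dots> = (\<Sum>f\<in>B. (q - 1) ^ N)"
    proof (rule sum.cong)
      fix f assume "f \<in> B"
      thus "card ({..<N} \<rightarrow>\<^sub>E ({..<q} - {a f})) = (q - 1) ^ N"
        using cP[of "{a f}"] less(1)[OF B(1)] by simp
    qed simp
    finally show ?thesis by simp
  qed
  have cY: "card Y = card common * ((q - 1) * (q - 2) ^ N)"
  proof -
    have inner: "card (SIGMA c:{..<q} - {a g}. {..<N} \<rightarrow>\<^sub>E ({..<q} - {a g, c})) = (q - 1) * (q - 2) ^ N"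
      if "g \<in> common" for g
    proof -
      have ag: "a g < q" using that less(1) by (auto simp: common_def)
      have "card (SIGMA c:{..<q} - {a g}. {..<N} \<rightarrow>\<^sub>E ({..<q} - {a g, c})) =
          (\<Sum>c\<in>{..<q} - {a g}. card ({..<N} \<rightarrow>\<^sub>E ({..<q} - {a g, c})))"
        by (intro card_SigmaI) (auto intro: finite_PiE)
      also have "\<dots> = (\<Sum>c\<in>{..<q} - {a g}. (q - 2) ^ N)"
      proof (rule sum.cong)
        fix c assume "c \<in> {..<q} - {a g}"
        thus "card ({..<N} \<rightarrow>\<^sub>E ({..<q} - {a g, c})) = (q - 2) ^ N"
          using cP[of "{a g, c}"] ag by (simp add: numeral_2_eq_2)
      qed simp
      finally show ?thesis using ag by simp
    qed
    have "card Y = (\<Sum>g\<in>common. card (SIGMA c:{..<q} - {a g}. {..<N} \<rightarrow>\<^sub>E ({..<q} - {a g, c})))"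
      unfolding Y_def using finB by (intro card_SigmaI) (auto intro!: finite_PiE finite_SigmaI)
    thus ?thesis using inner by simp
  qed
  have fY: "finite Y"
    unfolding Y_def using finB by (auto intro!: finite_PiE finite_SigmaI)
  have h: "h j < q \<and> h j \<noteq> a f" if "(f, h) \<in> X" "j < N" for f h j
  proof -
    have "h j \<in> {..<q} - {a f}" using that by (intro PiE_mem[of h "{..<N}"]) (auto simp: X_def)
    thus ?thesis by simp
  qed
  have "\<Phi> ` X \<subseteq> Y"
  proof
    fix y assume "y \<in> \<Phi> ` X"
    then obtain f h where fh: "(f, h) \<in> X" "y = \<Phi> (f, h)" by auto
    have f: "f \<in> B" using fh by (simp add: X_def)
    let ?g = "recolor (merge_colors S (a f) (b f) h) f"
    note g = merge_colors_coloring[OF B(1)[OF f], of h, folded a_def b_def, OF h[OF fh(1)]]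
    have "?g \<in> common" using g common_eq[of S] by (simp add: a_def b_def)
    moreover have "a ?g = a f" using g(2) by simp
    moreover have "b f \<in> {..<q} - {a f}" using B[OF f] less(2) by auto
    moreover have "restrict (\<lambda>j. f (enc (Joint j))) {..<N} \<in> {..<N} \<rightarrow>\<^sub>E ({..<q} - {a f, b f})"
    proof -
      have "f (enc (Joint j)) < q \<and> f (enc (Joint j)) \<noteq> chain_color s f" if "j < N" for j s
      proof -
        have "f (enc (Indep s j 0)) \<noteq> f (enc (Joint j))"
          using B(1)[OF f] link.IZ[OF that] unfolding colorings_graph by blast
        moreover have "Joint j \<in> V" using that by (auto simp: verts_def)
        ultimately show ?thesis
          using chain_color[OF B(1)[OF f] that, of 0 s] color_less[OF B(1)[OF f]] by auto
      qed
      thus ?thesis by (auto simp: a_def b_def PiE_iff)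
    qed
    ultimately show "y \<in> Y" by (simp add: fh(2) \<Phi>_def Y_def)
  qed
  moreover have "inj_on \<Phi> X"
  proof (rule inj_onI, clarify)
    fix f h f' h' assume X: "(f, h) \<in> X" "(f', h') \<in> X" and eq: "\<Phi> (f, h) = \<Phi> (f', h')"
    have f: "f \<in> B" "f' \<in> B" using X by (auto simp: X_def)
    define g where "g = recolor (merge_colors S (a f) (b f) h) f"
    have g': "g = recolor (merge_colors S (a f') (b f') h') f'" and bb: "b f' = b f"
      and zz: "restrict (\<lambda>j. f (enc (Joint j))) {..<N} = restrict (\<lambda>j. f' (enc (Joint j))) {..<N}"
      using eq by (auto simp: \<Phi>_def g_def)
    \<comment> \<open>Decoding: the chain color of \<open>g\<close> is \<open>a f\<close> and the
      image records \<open>b f\<close>, so the exchange of colors can be undone. The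
      \<open>Joint\<close> colors of \<open>f\<close> are recorded too, and those of
      \<open>g\<close> are \<open>h\<close>.\<close>
    have "chain_color True g = a f"
      unfolding g_def a_def b_def
      by (rule merge_colors_coloring(2)[OF B(1)[OF f(1)]]) (use h[OF X(1)] in \<open>simp add: a_def\<close>)
    moreover have "chain_color True g = a f'"
      unfolding g' a_def b_def
      by (rule merge_colors_coloring(2)[OF B(1)[OF f(2)]]) (use h[OF X(2)] in \<open>simp add: a_def\<close>)
    ultimately have aa: "a f' = a f" by simp
    have z: "f (enc (Joint j)) = f' (enc (Joint j))" if "j < N" for j
      using fun_cong[OF zz, of j] that by simp
    have val: "merge_colors S (a f) (b f) h x (f (enc x)) = merge_colors S (a f) (b f) h' x (f' (enc x))"
      if "x \<in> V" for x
      using recolor_enc[OF that] g' g_def aa bb by metis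
    have "f v = f' v" for v
    proof (cases "v \<in> enc ` V")
      case True
      then obtain x where x: "x \<in> V" "v = enc x" by blast
      show ?thesis
        using val[OF x(1)] z x by (cases x) (auto simp: merge_colors_def verts_def transpose_eq_transpose_iff split: if_splits)
    next
      case False
      then show ?thesis using g' g_def by (metis recolor_def)
    qed
    moreover have "h j = h' j" for j
    proof (cases "j < N")
      case True
      hence "Joint j \<in> V" by (auto simp: verts_def)
      thus ?thesis using val[of "Joint j"] by (simp add: merge_colors_def)
    next
      case False
      have "h \<in> extensional {..<N}" "h' \<in> extensional {..<N}"
        using X by (auto simp: X_def PiE_iff)
      then show ?thesis using False by (simp add: extensional_def)
    qed
    ultimately show "f = f' \<and> h = h'" by (simp add: fun_eq_iff)
  qed
  ultimately have "card X \<le> card Y" using fY by (metis card_image card_mono)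
  thus ?thesis by (simp add: cX cY B_def)
qed

end

section \<open>Sample complexity\<close>

lemma graphs_trivial:
  assumes "d = 0 \<or> n = 1" "G \<in> graphs n d"
  shows "G = {}"
proof (rule ccontr)
  assume "G \<noteq> {}"
  then obtain e where e: "e \<in> G" by blast
  obtain u v where uv: "e = {u, v}" "u < v" "v < n" by (rule graph_edge_cases[OF assms(2) e])
  have "card {e \<in> G. v \<in> e} \<noteq> 0" using e uv(1) finite_graph[OF assms(2)] by auto
  moreover have "card {e \<in> G. v \<in> e} \<le> d" using assms(2) uv(3) unfolding graphs_def by blast
  ultimately show False using assms(1) uv by auto
qed

lemma never_equal_colorings:
  assumes G: "G \<in> graphs n d" and xs: "set xs \<subseteq> colorings n q G"
    and sep: "\<And>u v. u < v \<Longrightarrow> v < n \<Longrightarrow> {u, v} \<notin> G \<Longrightarrow> \<exists>x\<in>set xs. x u = x v"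
  shows "never_equal n xs = G"
proof
  show "never_equal n xs \<subseteq> G"
  proof
    fix e assume "e \<in> never_equal n xs"
    then obtain u v where "e = {u, v}" "u < v" "v < n" "\<forall>x\<in>set xs. x u \<noteq> x v"
      unfolding never_equal_def by blast
    thus "e \<in> G" using sep by blast
  qed
  show "G \<subseteq> never_equal n xs"
  proof
    fix e assume e: "e \<in> G"
    obtain u v where uv: "e = {u, v}" "u < v" "v < n" by (rule graph_edge_cases[OF G e])
    have "\<forall>x\<in>set xs. x u \<noteq> x v" using xs e uv(1) unfolding colorings_def by blast
    thus "e \<in> never_equal n xs" using uv unfolding never_equal_def by blast
  qed
qed

text \<open>One sample keeps \<open>u\<close> and \<open>v\<close> apart with probability at most 1
  - 1/X \<le> exp (- 1/X), where X = 6 q d^3; independence raises this to the power L.\<close>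

lemma card_unseparated:
  assumes G: "G \<in> graphs n d" and "0 < d" "d < q" "u < v" "v < n" "{u, v} \<notin> G"
  shows "real (card (lists_of {f \<in> colorings n q G. f u \<noteq> f v} L)) \<le>
    exp (- real L / (6 * q * d ^ 3)) * card (lists_of (colorings n q G) L)"
proof -
  let ?\<Omega> = "colorings n q G" and ?X = "real (6 * q * d ^ 3)"
  have X: "?X > 0" using assms by simp
  have fin: "finite {f \<in> ?\<Omega>. f u = f v}" "finite {f \<in> ?\<Omega>. f u \<noteq> f v}"
    using finite_colorings[of n q G] by auto
  have "?\<Omega> = {f \<in> ?\<Omega>. f u = f v} \<union> {f \<in> ?\<Omega>. f u \<noteq> f v}" by blast
  hence "card ?\<Omega> = card ({f \<in> ?\<Omega>. f u = f v} \<union> {f \<in> ?\<Omega>. f u \<noteq> f v})" by (rule arg_cong)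
  also have "\<dots> = card {f \<in> ?\<Omega>. f u = f v} + card {f \<in> ?\<Omega>. f u \<noteq> f v}"
    using fin by (intro card_Un_disjoint) auto
  finally have split: "real (card ?\<Omega>) = card {f \<in> ?\<Omega>. f u = f v} + real (card {f \<in> ?\<Omega>. f u \<noteq> f v})"
    by simp
  have "real (card ?\<Omega>) / ?X \<le> card {f \<in> ?\<Omega>. f u = f v}"
    using equal_color_fraction[OF G assms(2,3), of u v] assms X by (simp add: divide_le_eq)
  hence "real (card {f \<in> ?\<Omega>. f u \<noteq> f v}) \<le> (1 + - (1 / ?X)) * card ?\<Omega>"
  proof -
    have "(1 + - (1 / ?X)) * card ?\<Omega> = card ?\<Omega> - card ?\<Omega> / ?X"
      by (simp only: distrib_right) simp
    thus ?thesis using split \<open>real (card ?\<Omega>) / ?X \<le> _\<close> by linarith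
  qed
  also have "\<dots> \<le> exp (- (1 / ?X)) * card ?\<Omega>"
    by (intro mult_right_mono exp_ge_add_one_self) auto
  finally have "real (card {f \<in> ?\<Omega>. f u \<noteq> f v}) ^ L \<le> (exp (- (1 / ?X)) * card ?\<Omega>) ^ L"
    by (intro power_mono) auto
  also have "\<dots> = exp (- real L / ?X) * real (card ?\<Omega>) ^ L"
    by (simp add: power_mult_distrib flip: exp_of_nat_mult)
  finally show ?thesis
    using fin finite_colorings[of n q G] by (simp add: card_lists_of)
qed

text \<open>A wrong output requires a non-adjacent pair that is never seen with equal colors; a
  union bound over at most n^2 pairs then gives \<epsilon>. For d = 0 or n = 1 the sample budget can
  be below 1, but the empty graph is the only candidate, so no sample is taken.\<close>

lemma structure_learning:
  fixes d q n :: nat and \<epsilon> :: real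
  assumes "d < q" "1 \<le> n" "0 < \<epsilon>" "\<epsilon> < 1"
  shows "\<exists>L F. real L \<le> 60 * (real q * real d ^ 3 * ln (real n ^ 2 / \<epsilon>)) \<and>
    computes learner n q d L (60 * (real L * real n ^ 2 + 1)) F \<and>
    structure_learner n q d L (1 - \<epsilon>) (\<lambda>xs. return_pmf (F xs))"
proof (cases "d = 0 \<or> n = 1")
  case True
  obtain F where F: "computes learner n q d 0 (60 * (real 0 * real n ^ 2 + 1)) F"
    "\<And>xs. xs \<in> sample_lists n q 0 \<Longrightarrow> F xs \<in> graphs n d" "\<And>xs. F xs = {}"
    using learner_computes[OF assms(2), of q d 0] by metis
  have "1 \<le> real n ^ 2 / \<epsilon>" 
  proof -
    have "\<epsilon> \<le> 1" "1 \<le> real n ^ 2" using assms by (auto intro: one_le_power)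
    thus ?thesis using assms(3) by (simp add: le_divide_eq)
  qed
  hence "0 \<le> ln (real n ^ 2 / \<epsilon>)" by simp
  moreover have "structure_learner n q d 0 (1 - \<epsilon>) (\<lambda>xs. return_pmf (F xs))"
    unfolding structure_learner_def
  proof (intro conjI ballI impI)
    show "learning_algorithm n q d 0 (\<lambda>xs. return_pmf (F xs))"
      using F(2) by (auto simp: learning_algorithm_def)
    fix G assume "G \<in> graphs n d"
    hence "G = {}" by (rule graphs_trivial[OF True])
    thus "1 - \<epsilon> \<le> measure_pmf.prob (output_pmf n q 0 (\<lambda>xs. return_pmf (F xs)) G) {G}"
      using assms(3) by (simp add: output_pmf_def F(3))
  qed
  ultimately show ?thesis using F(1) by (intro exI[of _ 0] exI[of _ F]) auto
next
  case False
  hence d: "1 \<le> d" and n: "2 \<le> n" using assms(2) by auto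
  define X where "X = real (6 * q * d ^ 3)"
  define l where "l = ln (real n ^ 2 / \<epsilon>)"
  define L where "L = nat \<lceil>X * l\<rceil>"
  \<comment> \<open>With n at least 2 the logarithm is at least 1, so rounding L up to an integer at
    most doubles X * l.\<close>
  have "exp 1 \<le> (4 :: real)" using exp_le by linarith
  also have "4 \<le> real n ^ 2" using power_mono[of 2 "real n" 2] n by simp
  also have "\<dots> \<le> real n ^ 2 / \<epsilon>"
    using assms(3,4) mult_left_mono[of \<epsilon> 1 "real n ^ 2"] by (simp add: le_divide_eq)
  finally have l: "1 \<le> l" unfolding l_def using assms n by (simp add: ln_ge_iff)
  have "1 \<le> q * d ^ 3" using assms(1) d by simp
  hence "1 \<le> 6 * q * d ^ 3" by linarith
  hence X: "1 \<le> X" unfolding X_def by (metis of_nat_1 of_nat_le_iff)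
  have "1 * 1 \<le> X * l" using X l by (intro mult_mono) auto
  hence Xl: "1 \<le> X * l" by simp
  have L: "X * l \<le> real L" "real L \<le> X * l + 1" "0 < L"
    unfolding L_def using Xl by linarith+
  have Lle: "real L \<le> 60 * (real q * real d ^ 3 * ln (real n ^ 2 / \<epsilon>))"
    using L(2) Xl by (simp add: X_def l_def)
  obtain F where F: "computes learner n q d L (60 * (real L * real n ^ 2 + 1)) F"
    "\<And>xs. xs \<in> sample_lists n q L \<Longrightarrow> F xs \<in> graphs n d"
    "\<And>xs. xs \<in> sample_lists n q L \<Longrightarrow> never_equal n xs \<in> graphs n d \<Longrightarrow> F xs = never_equal n xs"
    using learner_computes[OF assms(2), of q d L] L(3) by metis
  have "1 - \<epsilon> \<le> measure_pmf.prob (output_pmf n q L (\<lambda>xs. return_pmf (F xs)) G) {G}"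
    if G: "G \<in> graphs n d" and col: "colorable n q G" for G
  proof -
    let ?\<Omega> = "colorings n q G"
    define S where "S = lists_of ?\<Omega> L"
    define bad where "bad = {xs \<in> S. F xs \<noteq> G}"
    define pairs where "pairs = {(u, v). u < v \<and> v < n \<and> {u, v} \<notin> G}"
    have fS: "finite S" by (simp add: S_def finite_lists_of finite_colorings)
    have S0: "S \<noteq> {}" using col by (simp add: S_def colorable_def lists_of_nonempty)
    have pairs: "pairs \<subseteq> {..<n} \<times> {..<n}" by (auto simp: pairs_def)
    have fp: "finite pairs" by (rule finite_subset[OF pairs]) simp
    have cp: "real (card pairs) \<le> real n ^ 2"
    proof -
      have "card pairs \<le> card ({..<n} \<times> {..<n})" by (rule card_mono[OF _ pairs]) simp
      hence "card pairs \<le> n ^ 2" by (simp add: power2_eq_square)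
      thus ?thesis by (metis of_nat_le_iff of_nat_power)
    qed
    have "bad \<subseteq> (\<Union>(u, v)\<in>pairs. lists_of {f \<in> ?\<Omega>. f u \<noteq> f v} L)"
    proof (rule subsetI, rule ccontr)
      fix xs assume xs: "xs \<in> bad" and not: "xs \<notin> (\<Union>(u, v)\<in>pairs. lists_of {f \<in> ?\<Omega>. f u \<noteq> f v} L)"
      have sub: "set xs \<subseteq> ?\<Omega>" "length xs = L" using xs by (auto simp: bad_def S_def lists_of_def)
      have "\<exists>x\<in>set xs. x u = x v" if "u < v" "v < n" "{u, v} \<notin> G" for u v
      proof (rule ccontr)
        assume "\<not> (\<exists>x\<in>set xs. x u = x v)"
        hence "xs \<in> lists_of {f \<in> ?\<Omega>. f u \<noteq> f v} L" using sub by (auto simp: lists_of_def)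
        moreover have "(u, v) \<in> pairs" using that by (simp add: pairs_def)
        ultimately show False using not by blast
      qed
      hence "never_equal n xs = G" by (rule never_equal_colorings[OF G sub(1)])
      moreover have "xs \<in> sample_lists n q L"
        using sub by (auto simp: sample_lists_def colorings_def)
      ultimately have "F xs = G" using F(3) G by simp
      thus False using xs by (simp add: bad_def)
    qed
    hence "card bad \<le> card (\<Union>(u, v)\<in>pairs. lists_of {f \<in> ?\<Omega>. f u \<noteq> f v} L)"
      using fp finite_colorings[of n q G] by (intro card_mono) (auto intro!: finite_lists_of)
    also have "\<dots> \<le> (\<Sum>p\<in>pairs. card (case p of (u, v) \<Rightarrow> lists_of {f \<in> ?\<Omega>. f u \<noteq> f v} L))"
      by (rule card_UN_le[OF fp])
    finally have "real (card bad) \<le> real (\<Sum>p\<in>pairs. card (case p of (u, v) \<Rightarrow> lists_of {f \<in> ?\<Omega>. f u \<noteq> f v} L))"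
      by (rule of_nat_mono)
    also have "\<dots> = (\<Sum>p\<in>pairs. real (card (case p of (u, v) \<Rightarrow> lists_of {f \<in> ?\<Omega>. f u \<noteq> f v} L)))"
      by (rule of_nat_sum)
    also have "\<dots> \<le> (\<Sum>p\<in>pairs. exp (- real L / X) * card S)"
    proof (rule sum_mono)
      fix p assume "p \<in> pairs"
      then obtain u v where "p = (u, v)" "u < v" "v < n" "{u, v} \<notin> G" by (auto simp: pairs_def)
      thus "real (card (case p of (u, v) \<Rightarrow> lists_of {f \<in> ?\<Omega>. f u \<noteq> f v} L)) \<le> exp (- real L / X) * card S"
        using card_unseparated[OF G _ assms(1), of u v L] d by (simp add: X_def S_def)
    qed
    also have "\<dots> = card pairs * (exp (- real L / X) * card S)" by simp
    also have "\<dots> \<le> real n ^ 2 * (\<epsilon> / real n ^ 2 * card S)"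
    proof (rule mult_mono[OF cp])
      \<comment> \<open>The choice L \<ge> X * l makes the failure probability of a single pair at
        most \<epsilon> / n^2.\<close>
      have "- real L / X \<le> - l" using L(1) X by (simp add: field_simps)
      hence "exp (- real L / X) \<le> exp (- l)" by simp
      also have "\<dots> = \<epsilon> / real n ^ 2"
        unfolding l_def using assms n by (simp add: exp_minus)
      finally show "exp (- real L / X) * card S \<le> \<epsilon> / real n ^ 2 * card S"
        by (rule mult_right_mono) simp
    qed auto
    also have "\<dots> = \<epsilon> * card S" using n by simp
    finally have bad: "real (card bad) \<le> \<epsilon> * card S" .
    have cS: "card S > 0" using fS S0 by (simp add: card_gt_0_iff)
    have "measure_pmf.prob (output_pmf n q L (\<lambda>xs. return_pmf (F xs)) G) {G} =
        (\<Sum>xs\<in>S. measure_pmf.prob (return_pmf (F xs)) {G}) / card S"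
      unfolding output_pmf_eq[OF col] S_def[symmetric] by (rule prob_bind_pmf_of_set[OF fS S0])
    also have "(\<Sum>xs\<in>S. measure_pmf.prob (return_pmf (F xs)) {G}) = (\<Sum>xs\<in>S. 1 - (if F xs \<noteq> G then 1 else 0))"
      by (intro sum.cong) (auto simp: measure_return_pmf)
    also have "\<dots> = card S - real (card bad)"
      using fS by (simp add: sum_subtractf bad_def sum.If_cases Int_def)
    also have "(card S - real (card bad)) / card S \<ge> (card S - \<epsilon> * card S) / card S"
      using bad by (intro divide_right_mono) auto
    hence "(card S - real (card bad)) / card S \<ge> 1 - \<epsilon>"
      using cS by (simp add: diff_divide_distrib)
    finally show ?thesis .
  qed
  hence "structure_learner n q d L (1 - \<epsilon>) (\<lambda>xs. return_pmf (F xs))"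
    using F(2) by (auto simp: structure_learner_def learning_algorithm_def)
  with Lle F(1) show ?thesis by blast
qed

section \<open>Lower bound: samples that are necessary\<close>

context chains
begin

text \<open>The averaging bound for the 2^N graphs indexed by subsets of {..<N}: guessing among them
  succeeds with probability (1 / 2)^N on average, and the other term bounds the chance that some
  sample shows chains of different colors.\<close>

lemma success_bound:
  assumes A: "equivalent_structure_learner n q (q + t) L p A"
    and \<delta>: "real (q - 1) * ((real q - 2) / (real q - 1)) ^ N \<le> 1"
  shows "p \<le> L * (real (q - 1) * ((real q - 2) / (real q - 1)) ^ N) + (1 / 2) ^ N"
proof -
  define \<delta> where "\<delta> = real (q - 1) * ((real q - 2) / (real q - 1)) ^ N"
  have q1: "real (q - 1) = real q - 1" "real (q - 2) = real q - 2" "real q - 1 > 0" "real q - 2 > 0"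
    using q by (auto simp: of_nat_diff)
  have "card (Pow {..<N}) * p \<le> card (Pow {..<N}) * (L * \<delta>) + 1"
  proof (rule sum_success_le[where \<Omega>="\<lambda>S. colorings n q (graph S)" and D=common and A=A
        and T="\<lambda>S. {G'. colorings n q G' = colorings n q (graph S)}"])
    fix S
    show "colorings n q (graph S) \<noteq> {}" using rare_coloring by blast
    show sub: "common \<subseteq> colorings n q (graph S)" using common_eq[of S] by blast
    show "p \<le> measure_pmf.prob (pmf_of_set (lists_of (colorings n q (graph S)) L) \<bind> A)
        {G'. colorings n q G' = colorings n q (graph S)}"
      using A graph_in_graphs[of S] rare_coloring[of S] output_pmf_eq[of n q "graph S" L A]
      unfolding equivalent_structure_learner_def colorable_def by fastforce
    have "real (card (colorings n q (graph S) - common)) * (real q - 1) ^ N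
        \<le> card common * (real (q - 1) * (real q - 2) ^ N)"
      using card_rare[of S] q1(1,2) by (metis of_nat_le_iff of_nat_mult of_nat_power)
    hence "real (card (colorings n q (graph S) - common)) \<le> card common * \<delta>"
      using q1 by (simp add: \<delta>_def power_divide field_simps)
    also have "\<dots> \<le> card (colorings n q (graph S)) * \<delta>"
      using card_mono[OF finite_colorings sub] q1 by (intro mult_right_mono) (auto simp: \<delta>_def)
    finally show "real (card (colorings n q (graph S) - common)) \<le> \<delta> * card (colorings n q (graph S))"
      by (simp add: mult.commute)
  next
    show "disjoint_family_on (\<lambda>S. {G'. colorings n q G' = colorings n q (graph S)}) (Pow {..<N})"
      unfolding disjoint_family_on_def
    proof (intro ballI impI)
      fix S S' assume "S \<in> Pow {..<N}" "S' \<in> Pow {..<N}" "S \<noteq> S'"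
      hence "colorings n q (graph S) \<noteq> colorings n q (graph S')" by (intro colorings_graph_inj) auto
      thus "{G'. colorings n q G' = colorings n q (graph S)} \<inter>
          {G'. colorings n q G' = colorings n q (graph S')} = {}" by auto
    qed
    show "\<delta> \<le> 1" using \<delta> by (simp only: \<delta>_def)
  qed (simp_all add: finite_colorings)
  hence "2 ^ N * p \<le> 2 ^ N * (L * \<delta>) + 1" by (simp add: card_Pow)
  hence "2 ^ N * p \<le> 2 ^ N * (L * \<delta> + (1 / 2) ^ N)"
    by (simp only: distrib_left power_divide) simp
  thus ?thesis unfolding \<delta>_def by (rule mult_left_le_imp_le) simp
qed

end

lemma samples_lower_bound:
  fixes q t :: nat
  assumes q: "3 \<le> q" and t: "1 \<le> t" and qt: "q - 1 \<le> t * (t + 1)"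
  shows "\<exists>c>0. \<forall>\<^sub>F n in sequentially. \<forall>L A.
    equivalent_structure_learner n q (q + t) L (exp (- c * real n)) A \<longrightarrow> exp (c * real n) \<le> real L"
proof -
  define m where "m = 2 * (q + t) + 2"
  define r where "r = (real q - 2) / (real q - 1)"
  define \<mu> where "\<mu> = - ln r"
  \<comment> \<open>One factor exp (c n) comes from the bound on L, another from the success
    probability. Together they use up half of the decay rate \<mu> / m of r^N.\<close>
  define c where "c = \<mu> / (4 * m)"
  \<comment> \<open>The bound 1 / 2 \<le> r, valid from q = 3 on, lets r^N absorb the guessing term
    (1 / 2)^N.\<close>
  have r: "0 < r" "r < 1" "1 / 2 \<le> r" using q by (auto simp: r_def field_simps)
  have \<mu>: "\<mu> > 0" using r by (simp add: \<mu>_def)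
  have m: "real m > 0" by (simp add: m_def)
  have c: "c > 0" using \<mu> m by (simp add: c_def)
  have "(\<lambda>n. real q * exp \<mu> * exp (- (\<mu> / (2 * m)) * real n)) \<longlonglongrightarrow> 0"
  proof -
    have "(\<lambda>n. exp (- (\<mu> / (2 * m))) ^ n) \<longlonglongrightarrow> 0"
      using \<mu> m by (intro LIMSEQ_power_zero) simp
    from tendsto_mult_left[OF this, of "real q * exp \<mu>"] show ?thesis
      by (simp add: mult.commute flip: exp_of_nat_mult)
  qed
  hence "\<forall>\<^sub>F n in sequentially. real q * exp \<mu> * exp (- (\<mu> / (2 * m)) * real n) < 1"
    by (rule order_tendstoD) simp
  moreover have "\<forall>\<^sub>F n in sequentially. n \<ge> m" by (rule eventually_ge_at_top)
  ultimately have "\<forall>\<^sub>F n in sequentially. \<forall>L A.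
    equivalent_structure_learner n q (q + t) L (exp (- c * real n)) A \<longrightarrow> exp (c * real n) \<le> real L"
  proof eventually_elim
    case (elim n)
    define N where "N = n div m"
    have N: "1 \<le> N" using elim(2) m by (simp add: N_def div_greater_zero_iff Suc_le_eq)
    have "card (verts q t N) \<le> N * m" using card_verts(2)[of q t N] q by (simp add: m_def)
    also have "\<dots> \<le> card {..<n}" by (simp add: N_def)
    finally obtain enc where "enc ` verts q t N \<subseteq> {..<n}" "inj_on enc (verts q t N)"
      using card_le_inj[OF card_verts(1), of q "{..<n}" t N] q by auto
    then interpret chains n q t N enc
      using q t qt N by unfold_locales
    \<comment> \<open>Rounding in \<open>n div m\<close> loses at most one level, which accounts for
      the factor exp \<mu> in the limit above.\<close>
    have "real n / m - 1 \<le> real N"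
    proof -
      have "n < m * (N + 1)"
        unfolding N_def using m by (simp add: dividend_less_times_div)
      hence "real n < real (m * (N + 1))" by (rule of_nat_less_iff[THEN iffD2])
      hence "real n < (real N + 1) * m" by (simp add: algebra_simps)
      hence "real n / m < real N + 1" using m by (simp add: divide_less_eq)
      thus ?thesis by simp
    qed
    hence "- (real N * \<mu>) \<le> - ((real n / m - 1) * \<mu>)" using \<mu> by (simp add: mult_right_mono)
    moreover have "r ^ N = exp (- (real N * \<mu>))"
      using r by (simp add: \<mu>_def exp_of_nat_mult)
    ultimately have rN: "r ^ N \<le> exp (- ((real n / m - 1) * \<mu>))" by simp
    have eq: "real q * exp (2 * (c * n)) * exp (- ((real n / m - 1) * \<mu>)) =
        real q * exp \<mu> * exp (- (\<mu> / (2 * m)) * real n)"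
    proof -
      have "2 * (c * n) + - ((real n / m - 1) * \<mu>) = \<mu> + (- (\<mu> / (2 * m)) * real n)"
        using m by (simp add: c_def field_simps)
      thus ?thesis by (simp only: mult.assoc flip: exp_add)
    qed
    have small: "real q * exp (2 * (c * n)) * r ^ N < 1"
      using mult_left_mono[OF rN, of "real q * exp (2 * (c * n))"] elim(1) eq by simp
    have "real (q - 1) * r ^ N \<le> (real q * exp (2 * (c * n))) * r ^ N"
    proof (intro mult_right_mono)
      have "real (q - 1) * 1 \<le> real q * exp (2 * (c * n))" using c by (intro mult_mono) auto
      thus "real (q - 1) \<le> real q * exp (2 * (c * n))" by simp
    qed (use r in simp)
    hence \<delta>: "real (q - 1) * r ^ N \<le> 1" using small by linarith
    show ?case
    proof (intro allI impI, rule ccontr)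
      fix L A assume A: "equivalent_structure_learner n q (q + t) L (exp (- c * real n)) A"
        and "\<not> exp (c * real n) \<le> real L"
      hence L: "real L \<le> exp (c * n)" by simp
      have "exp (- c * n) \<le> L * (real (q - 1) * r ^ N) + (1 / 2) ^ N"
        using success_bound[OF A] \<delta> by (simp add: r_def)
      also have "\<dots> \<le> exp (c * n) * (real (q - 1) * r ^ N) + r ^ N"
        using L r by (intro add_mono mult_right_mono power_mono) auto
      also have "\<dots> \<le> exp (c * n) * (real (q - 1) * r ^ N) + exp (c * n) * r ^ N"
      proof -
        have "1 * r ^ N \<le> exp (c * n) * r ^ N" using c r by (intro mult_right_mono) auto
        thus ?thesis by simp
      qed
      also have "\<dots> = exp (c * n) * (real (q - 1) + 1) * r ^ N"
        by (simp only: ring_distribs mult_1_left mult_1_right)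
      also have "real (q - 1) + 1 = real q" using q by simp
      finally have "exp (c * n) * exp (- c * n) \<le> exp (c * n) * (exp (c * n) * real q * r ^ N)"
        by (rule mult_left_mono) simp
      also have "\<dots> = real q * exp (2 * (c * n)) * r ^ N"
        unfolding mult_2 exp_add by (simp only: ac_simps)
      also have "exp (c * n) * exp (- c * n) = 1" by (simp flip: exp_add)
      finally show False using small by linarith
    qed
  qed
  thus ?thesis using c by blast
qed

text \<open>With t = d - q the hypothesis reads sqrt d < t + 1/2. Squaring gives d < t * (t + 1) +
  1/4, and integrality removes the 1/4. This completed square is the origin of the constant
  1/2.\<close>

lemma degree_slack:
  fixes d q :: nat
  assumes "3 \<le> q" "real q < real d - sqrt (real d) + 1 / 2"
  obtains t where "d = q + t" "1 \<le> t" "q - 1 \<le> t * (t + 1)"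
proof -
  have "0 \<le> sqrt (real d)" by simp
  hence "q \<le> d" using assms by linarith
  define t where "t = d - q"
  have d: "d = q + t" using \<open>q \<le> d\<close> by (simp add: t_def)
  have lt: "sqrt (real d) < real t + 1 / 2" using assms(2) d by simp
  have "1 \<le> sqrt (real d)" using assms(1) d by simp
  hence "1 \<le> t" using lt by linarith
  have "real d = sqrt (real d) ^ 2" by simp
  also have "\<dots> < (real t + 1 / 2) ^ 2" using lt by (intro power_strict_mono) auto
  also have "\<dots> = real (t * (t + 1)) + 1 / 4" by (simp add: power2_eq_square algebra_simps)
  finally have "d \<le> t * (t + 1)" by linarith
  hence "q - 1 \<le> t * (t + 1)" using d by linarith
  thus ?thesis using that d \<open>1 \<le> t\<close> by blast
qed

theorem theorem3:
  shows
    "(\<exists>(P::com) (C::real). C > 0 \<and>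
        (\<forall>(d::nat) (q::nat) (n::nat) (\<epsilon>::real). d < q \<and> 1 \<le> n \<and> 0 < \<epsilon> \<and> \<epsilon> < 1 \<longrightarrow>
          (\<exists>(L::nat) (F::(nat \<Rightarrow> nat) list \<Rightarrow> nat set set).
             real L \<le> C * (real q * real d ^ 3 * ln (real n ^ 2 / \<epsilon>)) \<and>
             computes P n q d L (C * (real L * real n ^ 2 + 1)) F \<and>
             structure_learner n q d L (1 - \<epsilon>) (\<lambda>xs. return_pmf (F xs))))) \<and>
     (\<forall>(d::nat) (q::nat) (n::nat). 2 \<le> q \<and> q \<le> d \<and> q + 2 \<le> n \<longrightarrow>
        (\<exists>G1 \<in> graphs n d. \<exists>G2 \<in> graphs n d.
           colorable n q G1 \<and> colorable n q G2 \<and> G1 \<noteq> G2 \<and>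
           coloring_pmf n q G1 = coloring_pmf n q G2)) \<and>
     (\<exists>K::real. K > 0 \<and>
        (\<forall>(d::nat) (q::nat). 3 \<le> q \<and> real q < real d - sqrt (real d) + K \<longrightarrow>
          (\<exists>c::real. c > 0 \<and>
             (\<forall>\<^sub>F n::nat in sequentially.
                \<forall>(L::nat) (A::(nat \<Rightarrow> nat) list \<Rightarrow> nat set set pmf).
                  equivalent_structure_learner n q d L (exp (- c * real n)) A \<longrightarrow>
                  exp (c * real n) \<le> real L))))"
proof (intro conjI)
  show "\<exists>(P::com) (C::real). C > 0 \<and>
        (\<forall>(d::nat) (q::nat) (n::nat) (\<epsilon>::real). d < q \<and> 1 \<le> n \<and> 0 < \<epsilon> \<and> \<epsilon> < 1 \<longrightarrow>
          (\<exists>(L::nat) (F::(nat \<Rightarrow> nat) list \<Rightarrow> nat set set).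
             real L \<le> C * (real q * real d ^ 3 * ln (real n ^ 2 / \<epsilon>)) \<and>
             computes P n q d L (C * (real L * real n ^ 2 + 1)) F \<and>
             structure_learner n q d L (1 - \<epsilon>) (\<lambda>xs. return_pmf (F xs))))"
    using structure_learning by (intro exI[of _ learner] exI[of _ 60]) auto
  show "\<forall>(d::nat) (q::nat) (n::nat). 2 \<le> q \<and> q \<le> d \<and> q + 2 \<le> n \<longrightarrow>
        (\<exists>G1 \<in> graphs n d. \<exists>G2 \<in> graphs n d.
           colorable n q G1 \<and> colorable n q G2 \<and> G1 \<noteq> G2 \<and>
           coloring_pmf n q G1 = coloring_pmf n q G2)"
    using two_graphs_same_colorings by blast
  show "\<exists>K::real. K > 0 \<and>
        (\<forall>(d::nat) (q::nat). 3 \<le> q \<and> real q < real d - sqrt (real d) + K \<longrightarrow>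
          (\<exists>c::real. c > 0 \<and>
             (\<forall>\<^sub>F n::nat in sequentially.
                \<forall>(L::nat) (A::(nat \<Rightarrow> nat) list \<Rightarrow> nat set set pmf).
                  equivalent_structure_learner n q d L (exp (- c * real n)) A \<longrightarrow>
                  exp (c * real n) \<le> real L)))"
  proof (rule exI[of _ "1 / 2"], intro conjI allI impI)
    fix d q :: nat
    assume dq: "3 \<le> q \<and> real q < real d - sqrt (real d) + 1 / 2"
    then obtain t where t: "d = q + t" "1 \<le> t" "q - 1 \<le> t * (t + 1)"
      using degree_slack by blast
    show "\<exists>c::real. c > 0 \<and> (\<forall>\<^sub>F n::nat in sequentially.
        \<forall>(L::nat) (A::(nat \<Rightarrow> nat) list \<Rightarrow> nat set set pmf).
          equivalent_structure_learner n q d L (exp (- c * real n)) A \<longrightarrow> exp (c * real n) \<le> real L)"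
      unfolding t(1) using dq by (intro samples_lower_bound t) simp
  qed simp
qed

end
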